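(* Let $q$ be a prime power with $q\equiv1\pmod4$, $n$ an odd prime, $Q=\frac{q^n-1}{q-1}$ and $\beta\in\mathbb{F}_q^*$. Write the product of the distinct primes dividing $q^n-1$ as $k p_1\cdots p_s$ with $s\ge0$ and $p_1,\dots,p_s$ distinct primes (not dividing $k$), ordered so that $p_i\mid Q$ for $1\le i\le r$ and $p_i\nmid Q$ for $r<i\le s$. Let $\delta=1-\sum_{i=1}^s\frac1{p_i}$, $\delta_Q=1-\sum_{i=1}^r\frac1{p_i}$, and $k_Q$ the product of the primes dividing $k$ which divide $Q$. Assume $\delta>0$ and $$q^{\frac{n-1}{2}}>2\sqrt2\left(\frac{s-1}{\delta}+2\right)W(k)-\sqrt2\left(\frac{r-1+\delta_Q}{\delta}+1\right)W(k_Q).$$ Then $\mathcal{N}_\beta(q^n-1)>0$.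
   Context: For a divisor $m$ of $q^n-1$, $\xi\in\mathbb{F}_{q^n}^*$ is $m$-free if $\xi=\zeta^d$ with $d\mid m$, $\zeta\in\mathbb{F}_{q^n}^*$ implies $d=1$. $\mathcal{N}_\beta(m)$ is the number of $m$-free $\xi\in\mathbb{F}_{q^n}^*$ with $\mathrm{Tr}(\xi^2)=\beta$, where $\mathrm{Tr}:\mathbb{F}_{q^n}\to\mathbb{F}_q$ is the trace. $W(m)=2^{\nu(m)}$ with $\nu(m)$ the number of distinct prime divisors of $m$. *)

theory Defs
  imports Complex_Main "HOL-Library.Cardinality" "HOL-Number_Theory.Number_Theory"
begin

definition is_subfield :: "'a :: field set \<Rightarrow> bool" where
  "is_subfield K \<longleftrightarrow> 0 \<in> K \<and> 1 \<in> K \<and>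
     (\<forall>x\<in>K. \<forall>y\<in>K. x + y \<in> K \<and> x * y \<in> K) \<and>
     (\<forall>x\<in>K. - x \<in> K) \<and> (\<forall>x\<in>K. x \<noteq> 0 \<longrightarrow> inverse x \<in> K)"

text \<open>
  Trace from the field with \<open>q ^ n\<close> elements to its subfield with \<open>q\<close> elements, as the sum
  of the conjugates under the Frobenius map \<open>x \<mapsto> x ^ q\<close>. The value lies in the subfield
  but is typed as an element of the big field.
\<close>

definition field_trace :: "nat \<Rightarrow> nat \<Rightarrow> 'a :: field \<Rightarrow> 'a" where
  "field_trace q n x = (\<Sum>i<n. x ^ (q ^ i))"

definition m_free :: "nat \<Rightarrow> 'a :: field \<Rightarrow> bool" where
  "m_free m \<xi> \<longleftrightarrow> (\<forall>d \<zeta>. d dvd m \<longrightarrow> \<zeta> \<noteq> 0 \<longrightarrow> \<xi> = \<zeta> ^ d \<longrightarrow> d = 1)"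

definition num_free :: "nat \<Rightarrow> nat \<Rightarrow> 'a :: {field, finite} \<Rightarrow> nat \<Rightarrow> nat" where
  "num_free q n \<beta> m = card {\<xi> :: 'a. \<xi> \<noteq> 0 \<and> m_free m \<xi> \<and> field_trace q n (\<xi> ^ 2) = \<beta>}"

definition W :: "nat \<Rightarrow> nat" where
  "W m = 2 ^ card (prime_factors m)"

end

theory Submission
  imports Defs "HOL-Computational_Algebra.Polynomial" "HOL-Library.Product_Plus"
begin

text \<open>
  The multiplicative characters \<open>\<eta>\<close> of the big field have explicit absolute values on trace
  fibres: counting the \<open>y\<close> with \<open>Tr y = Tr (y t) = \<beta>\<close> shows that \<open>\<bar>\<Sum>{\<eta> y | Tr y = \<beta>}\<bar>\<^sup>2\<close> is
  \<open>q ^ (n - 1)\<close> if \<open>\<eta>\<close> is nontrivial on the subfield and \<open>q ^ (n - 2)\<close> if only its restriction is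
  trivial; no additive characters are needed. Since \<open>4\<close> divides \<open>q ^ n - 1\<close>, a character of
  squarefree order is a square \<open>\<eta>\<^sup>2\<close>, and its sum over \<open>Tr (\<xi>\<^sup>2) = \<beta>\<close> is the sum of the fibre sums
  of \<open>\<eta>\<close> and of \<open>\<eta>\<close> times the quadratic character, at most one of which is trivial on the subfield.
  Detecting \<open>l\<close>-th powers one prime at a time gives the bounds for \<open>k\<close>-free elements, and the sieve
  removes the remaining primes.  The outcome has constants \<open>2\<close> and \<open>1 - 1 / sqrt q\<close> in place of
  \<open>2 sqrt 2\<close> and \<open>sqrt 2\<close>; the stated criterion implies it, except for \<open>q = 5\<close> with \<open>2\<close> among at least
  eight sieving primes, where the sharper criterion holds outright.
\<close>

subsection \<open>Finite fields and the trace\<close>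

text \<open>Cyclicity of the unit group is available for fields given as records, so the type is
  packaged as the record \<open>R\<close> and its powers are translated back.\<close>

lemma finite_field_generator_exists:
  "\<exists>g :: 'a :: {field, finite}. g \<noteq> 0 \<and> (\<forall>x. x \<noteq> 0 \<longrightarrow> (\<exists>i. x = g ^ i))"
proof -
  define R :: "'a ring" where
    "R = \<lparr>carrier = UNIV, monoid.mult = (*), one = 1, ring.zero = 0, add = (+)\<rparr>"
  have "\<exists>y. x + y = 0" for x :: 'a
    by (rule exI[of _ "- x"]) simp
  moreover have "\<exists>y. x * y = 1" if "x \<noteq> 0" for x :: 'a
    using that by (intro exI[of _ "inverse x"]) simp
  ultimately interpret R: field R
    unfolding R_def by unfold_locales (auto simp: algebra_simps Units_def)
  have pow: "x [^]\<^bsub>R\<^esub> i = x ^ i" for x :: 'a and i :: nat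
    by (induction i) (simp_all add: R_def)
  have carr: "carrier (mult_of R) = {x. x \<noteq> 0}"
    by (auto simp: R_def)
  obtain g where g: "g \<in> carrier (mult_of R)"
    and gen: "carrier (mult_of R) = {g [^]\<^bsub>R\<^esub> i | i::nat. i \<in> UNIV}"
    using R.finite_field_mult_group_has_gen by (auto simp: R_def)
  have "g \<noteq> 0" using g unfolding carr by simp
  moreover have "\<exists>i. x = g ^ i" if "x \<noteq> 0" for x
  proof -
    have "x \<in> {g [^]\<^bsub>R\<^esub> i | i::nat. i \<in> UNIV}"
      using that gen carr by blast
    thus ?thesis by (auto simp: pow)
  qed
  ultimately show ?thesis by blast
qed

text \<open>Multiplication by \<open>x\<close> permutes the units, so their product equals itself
  times \<open>x ^ (CARD('a) - 1)\<close>.\<close>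

lemma power_card_field_units:
  fixes x :: "'a :: {field, finite}"
  assumes "x \<noteq> 0"
  shows "x ^ (CARD('a) - 1) = 1"
proof -
  let ?P = "\<Prod>y\<in>UNIV - {0}. y :: 'a"
  have "bij_betw ((*) x) (UNIV - {0}) (UNIV - {0})"
    using assms by (intro bij_betwI[of _ _ _ "\<lambda>y. y / x"]) auto
  hence "(\<Prod>y\<in>UNIV - {0}. x * y) = ?P"
    by (rule prod.reindex_bij_betw)
  moreover have "(\<Prod>y\<in>UNIV - {0}. x * y) = x ^ (CARD('a) - 1) * ?P"
    by (simp add: prod.distrib card_Diff_singleton)
  moreover have "?P \<noteq> 0" by simp
  ultimately show ?thesis by simp
qed

lemma CHAR_finite_field:
  assumes "prime l" and "CARD('a :: {field, finite}) = l ^ e"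
  shows "CHAR('a) = l"
proof -
  have "CHAR('a) > 0"
    by (rule finite_imp_CHAR_pos) simp
  hence prm: "prime CHAR('a)"
    by (rule prime_CHAR_semidom)
  have "CHAR('a) dvd l ^ e"
    using CHAR_dvd_CARD[where ?'a = 'a] assms(2) by simp
  thus ?thesis
    using prm assms(1) prime_dvd_power primes_dvd_imp_eq by blast
qed

locale finite_field_extension =
  fixes q n :: nat and K :: "'a :: {field, finite} set" and g :: 'a
  assumes primepow_q: "primepow q" and n_ge2: "n \<ge> 2"
    and card_field: "CARD('a) = q ^ n"
    and subfield: "is_subfield K" and card_K: "card K = q"
    and g_nz: "g \<noteq> 0" and gen: "\<And>x. x \<noteq> 0 \<Longrightarrow> \<exists>i. x = g ^ i"
begin

abbreviation Tr :: "'a \<Rightarrow> 'a" where "Tr \<equiv> field_trace q n"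

definition N :: nat where "N = q ^ n - 1"

definition Q :: nat where "Q = N div (q - 1)"

lemma q_gt1: "q > 1"
  using primepow_q primepow_gt_Suc_0 by simp

lemma q_pow_gt1: "q ^ n > 1"
  using q_gt1 n_ge2 by (metis one_less_power not_numeral_le_zero zero_less_iff_neq_zero)

lemma N_pos: "N > 0"
  using q_pow_gt1 by (simp add: N_def)

lemma N_eq: "N = Q * (q - 1)"
proof -
  have "int q - 1 dvd int q ^ n - 1"
    using power_diff_1_eq[of "int q" n] by simp
  hence "int (q - 1) dvd int (q ^ n - 1)"
    using q_gt1 q_pow_gt1 by (simp add: of_nat_diff)
  thus ?thesis
    unfolding Q_def N_def by (simp only: of_nat_dvd_iff dvd_div_mult_self)
qed

lemma Q_pos: "Q > 0"
  using N_eq N_pos by (cases Q) auto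

lemma Q_eq_sum: "Q = (\<Sum>i<n. q ^ i)"
proof -
  have "int q ^ n - 1 = (int q - 1) * (\<Sum>i<n. int q ^ i)"
    by (rule power_diff_1_eq)
  hence "int (q ^ n - 1) = int ((q - 1) * (\<Sum>i<n. q ^ i))"
    using q_gt1 q_pow_gt1 by (simp add: of_nat_diff)
  hence "N = (\<Sum>i<n. q ^ i) * (q - 1)"
    unfolding N_def by (simp only: of_nat_eq_iff mult.commute)
  thus ?thesis
    unfolding Q_def using q_gt1 by simp
qed

lemma power_N: "(x :: 'a) \<noteq> 0 \<Longrightarrow> x ^ N = 1"
  using power_card_field_units[of x] by (simp add: N_def card_field)

lemma frob_pow_dream: "(x + y :: 'a) ^ q ^ i = x ^ q ^ i + y ^ q ^ i"
proof -
  obtain l e where l: "prime l" "q = l ^ e"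
    using primepow_q by (auto simp: primepow_def)
  have "CHAR('a) = l"
    by (rule CHAR_finite_field[of l "e * n"]) (use l card_field in \<open>simp_all add: power_mult\<close>)
  thus ?thesis
    using l by (intro freshmans_dream'[where n = "e * i"]) (simp_all add: power_mult)
qed

lemma frob_sum: "(\<Sum>i\<in>A. f i :: 'a) ^ q = (\<Sum>i\<in>A. f i ^ q)"
proof -
  have "(x + y) ^ q = x ^ q + y ^ q" for x y :: 'a
    using frob_pow_dream[of x y 1] by simp
  thus ?thesis
    using q_gt1 by (induction A rule: infinite_finite_induct) simp_all
qed

lemma K_closed:
  "0 \<in> K" "1 \<in> K" "x \<in> K \<Longrightarrow> y \<in> K \<Longrightarrow> x + y \<in> K" "x \<in> K \<Longrightarrow> y \<in> K \<Longrightarrow> x * y \<in> K"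
  "x \<in> K \<Longrightarrow> - x \<in> K" "x \<in> K \<Longrightarrow> inverse x \<in> K"
  using subfield by (auto simp: is_subfield_def)

lemma K_unit_power:
  assumes "c \<in> K" "c \<noteq> 0"
  shows "c ^ (q - 1) = 1"
proof -
  let ?P = "\<Prod>y\<in>K - {0}. y"
  have "bij_betw ((*) c) (K - {0}) (K - {0})"
    using assms K_closed
    by (intro bij_betwI[of _ _ _ "\<lambda>y. inverse c * y"]) (auto simp flip: mult.assoc)
  hence "(\<Prod>y\<in>K - {0}. c * y) = ?P"
    by (rule prod.reindex_bij_betw)
  moreover have "(\<Prod>y\<in>K - {0}. c * y) = c ^ (q - 1) * ?P"
    using K_closed by (simp add: prod.distrib card_Diff_singleton card_K)
  moreover have "?P \<noteq> 0" by simp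
  ultimately show ?thesis by simp
qed

lemma K_power: "c \<in> K \<Longrightarrow> c ^ q = c"
  using K_unit_power[of c] q_gt1 power_minus_mult[of q c]
  by (cases "c = 0") simp_all

lemma K_power_power: "c \<in> K \<Longrightarrow> c ^ q ^ i = c"
  by (induction i) (simp_all add: power_mult K_power)

text \<open>The polynomial \<open>x ^ q - x\<close> has at most \<open>q\<close> roots, and
  \<open>K\<close> already supplies \<open>q\<close> of them.\<close>

lemma K_iff_power: "x \<in> K \<longleftrightarrow> x ^ q = x"
proof -
  let ?f = "Polynomial.monom 1 q + Polynomial.monom (- 1) 1 :: 'a poly"
  have deg: "degree ?f = q"
    using q_gt1 by (subst degree_add_eq_left) (simp_all add: degree_monom_eq)
  hence "?f \<noteq> 0" using q_gt1 by auto
  hence "card {x. poly ?f x = 0} \<le> q"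
    using card_poly_roots_bound[of ?f] deg by simp
  hence "card {x::'a. x ^ q = x} \<le> card K"
    by (simp add: poly_monom card_K)
  moreover have "K \<subseteq> {x. x ^ q = x}" using K_power by auto
  ultimately have "K = {x. x ^ q = x}"
    by (intro card_seteq) auto
  thus ?thesis by auto
qed

section \<open>The trace onto \<open>K\<close> and the sizes of its fibres\<close>

lemma Tr_0: "Tr 0 = 0"
  using q_gt1 by (simp add: field_trace_def power_0_left)

lemma Tr_add: "Tr (x + y) = Tr x + Tr y"
  by (simp add: field_trace_def frob_pow_dream sum.distrib)

lemma Tr_scale: "c \<in> K \<Longrightarrow> Tr (c * x) = c * Tr x"
  by (simp add: field_trace_def power_mult_distrib K_power_power sum_distrib_left)

lemma Tr_diff: "Tr (x - y) = Tr x - Tr y"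
  using Tr_add[of "x - y" y] by simp

text \<open>Frobenius shifts the conjugates cyclically, since \<open>x ^ q ^ n = x\<close>, so it
  fixes their sum.\<close>

lemma Tr_in_K: "Tr x \<in> K"
proof -
  have xq: "x ^ q ^ n = x"
    using power_N[of x] q_gt1 power_minus_mult[of "q ^ n" x]
    by (cases "x = 0") (simp_all add: N_def)
  have "Tr x ^ q = (\<Sum>i<n. x ^ q ^ Suc i)"
    by (simp add: field_trace_def frob_sum power_mult[symmetric] mult.commute)
  also have "\<dots> = (\<Sum>i<n. x ^ q ^ i)"
    using sum.lessThan_Suc_shift[of "\<lambda>i. x ^ q ^ i" n] sum.lessThan_Suc[of "\<lambda>i. x ^ q ^ i" n] xq
    by (simp add: add.commute)
  finally show ?thesis by (simp add: K_iff_power field_trace_def)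
qed

text \<open>The trace is a polynomial of degree at most \<open>q ^ (n - 1)\<close>, nonzero because
  its linear coefficient is \<open>1\<close>; it has too few roots to vanish on all
  \<open>q ^ n\<close> elements.\<close>

lemma Tr_nonzero_exists: "\<exists>x. Tr x \<noteq> 0"
proof (rule ccontr)
  assume "\<not> ?thesis"
  hence all: "Tr x = 0" for x by auto
  let ?f = "\<Sum>i<n. Polynomial.monom 1 (q ^ i) :: 'a poly"
  have ev: "poly ?f x = Tr x" for x
    by (simp add: field_trace_def poly_sum poly_monom)
  have "degree ?f \<le> q ^ (n - 1)"
    using q_gt1 by (intro degree_sum_le) (auto simp: degree_monom_eq intro!: power_increasing)
  moreover have "coeff ?f 1 = 1"
  proof -
    have "coeff ?f 1 = (\<Sum>i<n. if i = 0 then 1 else 0)"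
      unfolding coeff_sum coeff_monom using q_gt1
      by (intro sum.cong) auto
    thus ?thesis using n_ge2 by simp
  qed
  hence "?f \<noteq> 0" by auto
  ultimately have "card {x::'a. Tr x = 0} \<le> q ^ (n - 1)"
    using card_poly_roots_bound[of ?f] ev by auto
  hence "q ^ n \<le> q ^ (n - 1)" using all card_field by simp
  thus False using q_gt1 n_ge2 by (simp add: power_increasing_iff)
qed

lemma Tr_surj: "b \<in> K \<Longrightarrow> \<exists>x. Tr x = b"
proof -
  assume b: "b \<in> K"
  obtain x where "Tr x \<noteq> 0" using Tr_nonzero_exists by blast
  hence "Tr (b * inverse (Tr x) * x) = b"
    using Tr_scale[of "b * inverse (Tr x)" x] b K_closed Tr_in_K by simp
  thus ?thesis by blast
qed

text \<open>All fibres are translates of the kernel. The general target type covers both the trace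
  and the pair \<open>(Tr x, Tr (x * t))\<close>.\<close>

lemma card_additive_fibre:
  fixes f :: "'a \<Rightarrow> 'b :: ab_group_add"
  assumes add: "\<And>x y. f (x + y) = f x + f y"
    and range: "\<And>x. f x \<in> B" and onto: "\<And>b. b \<in> B \<Longrightarrow> \<exists>x. f x = b"
    and "finite B" and b: "b \<in> B"
  shows "card {x. f x = b} * card B = q ^ n"
proof -
  have diff: "f (x - y) = f x - f y" for x y
    using add[of "x - y" y] by (simp add: algebra_simps)
  have fib: "card {x. f x = 0} = card {x. f x = c}" if c: "c \<in> B" for c
  proof -
    obtain x0 where x0: "f x0 = c" using onto c by blast
    have "bij_betw (\<lambda>x. x + x0) {x. f x = 0} {x. f x = c}"
      by (intro bij_betwI[of _ _ _ "\<lambda>x. x - x0"]) (auto simp: add diff x0)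
    thus ?thesis by (rule bij_betw_same_card)
  qed
  have "UNIV = (\<Union>c\<in>B. {x. f x = c})"
    using range by auto
  hence "q ^ n = card (\<Union>c\<in>B. {x. f x = c})"
    by (simp flip: card_field)
  also have "\<dots> = (\<Sum>c\<in>B. card {x. f x = c})"
    using \<open>finite B\<close> by (intro card_UN_disjoint) auto
  also have "\<dots> = (\<Sum>c\<in>B. card {x. f x = b})"
    using fib[OF b] by (intro sum.cong refl) (simp add: fib[symmetric])
  finally show ?thesis by (simp add: mult.commute)
qed

lemma card_Tr_fibre:
  assumes "b \<in> K"
  shows "card {x. Tr x = b} = q ^ (n - 1)"
proof -
  have "card {x. Tr x = b} * card K = q ^ n"
    by (rule card_additive_fibre) (use assms Tr_surj Tr_in_K Tr_add in auto)
  also have "\<dots> = q ^ (n - 1) * q" using n_ge2 power_minus_mult[of n q] by simp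
  finally show ?thesis using q_gt1 by (simp add: card_K)
qed

text \<open>For \<open>t\<close> outside \<open>K\<close> the functionals \<open>Tr x\<close> and
  \<open>Tr (x * t)\<close> are linearly independent over \<open>K\<close>, so together they map
  onto \<open>K \<times> K\<close>.\<close>

lemma card_Tr_pair_fibre:
  assumes "t \<notin> K" "b \<in> K" "c \<in> K"
  shows "card {x. Tr x = b \<and> Tr (x * t) = c} = q ^ (n - 2)"
proof -
  obtain a0 where a0: "Tr a0 = 1" using Tr_surj[OF K_closed(2)] by blast
  have "\<exists>x. Tr x = 0 \<and> Tr (x * t) \<noteq> 0"
  proof (rule ccontr)
    assume "\<not> ?thesis"
    hence *: "Tr (x * t) = 0" if "Tr x = 0" for x using that by blast
    \<comment> \<open>Splitting \<open>x\<close> along \<open>a0\<close> turns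
      \<open>Tr (x * t)\<close> into \<open>Tr x * Tr (a0 * t)\<close>, so
      \<open>t - Tr (a0 * t)\<close> is orthogonal to everything under the trace form and would have
      to be \<open>0\<close>, putting \<open>t\<close> in \<open>K\<close>.\<close>
    have zero: "Tr (x * (t - Tr (a0 * t))) = 0" for x
    proof -
      have "Tr (x - Tr x * a0) = 0"
        using Tr_in_K by (simp add: Tr_diff Tr_scale a0)
      hence "Tr ((x - Tr x * a0) * t) = 0" by (rule *)
      hence "Tr (x * t) = Tr x * Tr (a0 * t)"
        using Tr_in_K by (simp add: left_diff_distrib Tr_diff mult.assoc Tr_scale)
      thus ?thesis
        using Tr_in_K Tr_scale[of "Tr (a0 * t)" x]
        by (simp add: right_diff_distrib Tr_diff mult.commute)
    qed
    have "t - Tr (a0 * t) \<noteq> 0" using assms(1) Tr_in_K[of "a0 * t"] by auto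
    hence "Tr y = 0" for y
      using zero[of "y / (t - Tr (a0 * t))"] by simp
    thus False using Tr_nonzero_exists by blast
  qed
  then obtain x1 where x1: "Tr x1 = 0" "Tr (x1 * t) \<noteq> 0" by blast
  have onto: "\<exists>x. (Tr x, Tr (x * t)) = p" if p: "p \<in> K \<times> K" for p
  proof -
    obtain u v where uv: "p = (u, v)" "u \<in> K" "v \<in> K" using p by auto
    \<comment> \<open>\<open>a0\<close> sets the first trace to \<open>u\<close>; adding a multiple
      of \<open>x1\<close> leaves it alone, and the multiple \<open>w\<close> corrects the second
      trace to \<open>v\<close>.\<close>
    define w where "w = (v - u * Tr (a0 * t)) * inverse (Tr (x1 * t))"
    have w: "w \<in> K"
      unfolding w_def diff_conv_add_uminus
      by (intro K_closed Tr_in_K uv)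
    have "Tr (u * a0 + w * x1) = u"
      using uv w by (simp add: Tr_add Tr_scale a0 x1)
    moreover have "Tr ((u * a0 + w * x1) * t) = v"
      using uv w x1(2) by (simp add: distrib_right mult.assoc Tr_add Tr_scale) (simp add: w_def mult.assoc)
    ultimately show ?thesis using uv by auto
  qed
  have "card {x. (Tr x, Tr (x * t)) = (b, c)} * card (K \<times> K) = q ^ n"
  proof (rule card_additive_fibre)
    show "(Tr (x + y), Tr ((x + y) * t)) = (Tr x, Tr (x * t)) + (Tr y, Tr (y * t))" for x y
      by (simp add: Tr_add distrib_right)
    show "(Tr x, Tr (x * t)) \<in> K \<times> K" for x
      using Tr_in_K by simp
    show "\<exists>x. (Tr x, Tr (x * t)) = p" if "p \<in> K \<times> K" for p
      using that by (rule onto)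
    show "(b, c) \<in> K \<times> K"
      using assms by simp
  qed simp
  moreover have "q ^ n = q ^ (n - 2) * (q * q)"
    using n_ge2 by (metis le_add_diff_inverse2 power2_eq_square power_add)
  ultimately have "card {x. (Tr x, Tr (x * t)) = (b, c)} * (q * q) = q ^ (n - 2) * (q * q)"
    by (simp add: card_cartesian_product card_K)
  thus ?thesis using q_gt1 by simp
qed


end

subsection \<open>Multiplicative characters on trace fibres\<close>

context finite_field_extension
begin

text \<open>A primitive \<open>N\<close>-th root of unity.\<close>

definition \<omega> :: complex where "\<omega> = cis (2 * pi / real N)"

lemma omega_power_eq_1_iff: "\<omega> ^ a = 1 \<longleftrightarrow> N dvd a"
proof -
  have "\<omega> ^ a = cis (2 * pi * real a / real N)"
    by (simp add: \<omega>_def DeMoivre mult.commute)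
  also have "\<dots> = 1 \<longleftrightarrow> (\<exists>k. 2 * pi * real a / real N = 2 * pi * of_int k)"
  proof
    assume "cis (2 * pi * real a / real N) = 1"
    hence "cos (2 * pi * real a / real N) = 1" by (simp add: complex_eq_iff)
    thus "\<exists>k. 2 * pi * real a / real N = 2 * pi * of_int k"
      unfolding cos_one_2pi_int by (simp add: mult_ac)
  next
    assume "\<exists>k. 2 * pi * real a / real N = 2 * pi * of_int k"
    thus "cis (2 * pi * real a / real N) = 1"
      using cis_multiple_2pi Ints_of_int by metis
  qed
  also have "\<dots> \<longleftrightarrow> (\<exists>k. real_of_int (int a) = of_int (int N * k))"
    using N_pos by (simp add: field_simps)
  also have "\<dots> \<longleftrightarrow> int N dvd int a"
    by (simp only: of_int_eq_iff dvd_def)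
  finally show ?thesis by simp
qed

lemma norm_omega_power [simp]: "norm (\<omega> ^ a) = 1"
  by (simp add: \<omega>_def norm_power)

lemma omega_power_cong: "[a = b] (mod N) \<Longrightarrow> \<omega> ^ a = \<omega> ^ b"
proof (induction a b rule: linorder_wlog)
  case (le a b)
  hence "N dvd b - a" by (metis cong_altdef_nat cong_sym)
  hence "\<omega> ^ (b - a) = 1" by (simp add: omega_power_eq_1_iff)
  thus ?case using le power_add[of \<omega> a "b - a"] by simp
qed (simp add: cong_sym)

text \<open>The first \<open>N\<close> powers of \<open>g\<close> exhaust the \<open>N\<close>
  units, so by counting they are distinct.\<close>

lemma g_power_inj: "g ^ a = g ^ b \<Longrightarrow> [a = b] (mod N)"
proof -
  assume eq: "g ^ a = g ^ b"
  have red: "g ^ c = g ^ (c mod N)" for c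
  proof -
    have "g ^ c = g ^ (N * (c div N) + c mod N)" by simp
    also have "\<dots> = g ^ (c mod N)"
      unfolding power_add power_mult using power_N[OF g_nz] by simp
    finally show ?thesis .
  qed
  have "(\<lambda>i. g ^ i) ` {..<N} = UNIV - {0}"
  proof (intro equalityI subsetI)
    fix x assume "x \<in> UNIV - {0 :: 'a}"
    then obtain i where "x = g ^ i" using gen by auto
    hence "x = g ^ (i mod N)" using red by simp
    thus "x \<in> (\<lambda>i. g ^ i) ` {..<N}" using N_pos by simp
  qed (use g_nz in auto)
  hence "card ((\<lambda>i. g ^ i) ` {..<N}) = card {..<N}"
    by (simp add: card_Diff_singleton card_field N_def)
  hence "inj_on (\<lambda>i. g ^ i) {..<N}"
    by (intro eq_card_imp_inj_on) auto
  moreover have "g ^ (a mod N) = g ^ (b mod N)" using eq red by simp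
  ultimately show ?thesis
    using N_pos by (auto simp: inj_on_def cong_def)
qed

text \<open>The chosen exponent is not reduced; only its class modulo \<open>N\<close>
  matters.\<close>

definition dlog :: "'a \<Rightarrow> nat" where "dlog x = (SOME i. x = g ^ i)"

text \<open>The multiplicative characters, indexed by exponents modulo \<open>N\<close>; the value at \<open>0\<close> is junk.\<close>
definition ch :: "nat \<Rightarrow> 'a \<Rightarrow> complex" where "ch j x = \<omega> ^ (j * dlog x)"

lemma g_power_dlog: "x \<noteq> 0 \<Longrightarrow> g ^ dlog x = x"
  unfolding dlog_def using someI_ex[OF gen] by metis

lemma ch_g_power: "ch j (g ^ a) = \<omega> ^ (j * a)"
proof -
  have "g ^ dlog (g ^ a) = g ^ a" using g_nz by (intro g_power_dlog) simp
  hence "[dlog (g ^ a) = a] (mod N)" by (rule g_power_inj)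
  thus ?thesis unfolding ch_def by (intro omega_power_cong cong_scalar_left)
qed

lemma ch_mult:
  assumes "x \<noteq> 0" "y \<noteq> 0"
  shows "ch j (x * y) = ch j x * ch j y"
proof -
  obtain a b where "x = g ^ a" "y = g ^ b" using gen assms by metis
  thus ?thesis by (simp add: ch_g_power distrib_left power_add flip: power_add)
qed

lemma ch_1 [simp]: "ch j 1 = 1"
  using ch_g_power[of j 0] by simp

lemma ch_0_left [simp]: "ch 0 x = 1"
  by (simp add: ch_def)

lemma norm_ch [simp]: "norm (ch j x) = 1"
  by (simp add: ch_def)

lemma ch_add: "ch (i + j) x = ch i x * ch j x"
  by (simp add: ch_def distrib_right power_add)

lemma ch_mult_left: "ch (j * m) x = ch j x ^ m"
  by (simp add: ch_def mult_ac flip: power_mult)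

lemma ch_power:
  assumes "x \<noteq> 0"
  shows "ch j (x ^ m) = ch j x ^ m"
  using assms by (induction m) (simp_all add: ch_mult)

lemma ch_cnj_mult: "ch j x * cnj (ch j x) = 1"
  by (simp add: complex_norm_square[symmetric])

lemma ch_N_dvd: "N dvd j \<Longrightarrow> ch j x = 1"
  by (simp add: ch_def omega_power_eq_1_iff)

text \<open>Translating by \<open>c\<close> multiplies the sum by \<open>ch j c\<close>, which
  differs from \<open>1\<close>.\<close>

lemma sum_ch_subgroup:
  assumes "c \<in> H" "ch j c \<noteq> 1" and nz: "0 \<notin> H"
    and bij: "bij_betw ((*) c) H H"
  shows "(\<Sum>x\<in>H. ch j x) = 0"
proof -
  have c: "c \<noteq> 0" using assms by auto
  have "(\<Sum>x\<in>H. ch j x) = (\<Sum>x\<in>H. ch j (c * x))"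
    using bij by (rule sum.reindex_bij_betw[symmetric])
  also have "\<dots> = (\<Sum>x\<in>H. ch j c * ch j x)"
    by (rule sum.cong[OF refl], rule ch_mult) (use nz c in auto)
  also have "\<dots> = ch j c * (\<Sum>x\<in>H. ch j x)"
    by (simp add: sum_distrib_left)
  finally show ?thesis using assms(2) by simp
qed

lemma sum_ch_units:
  assumes "\<not> N dvd j"
  shows "(\<Sum>x\<in>UNIV - {0}. ch j x) = 0"
proof (rule sum_ch_subgroup)
  show "ch j g \<noteq> 1"
    using assms ch_g_power[of j 1] omega_power_eq_1_iff[of j] by simp
  show "bij_betw ((*) g) (UNIV - {0}) (UNIV - {0})"
    using g_nz by (intro bij_betwI[of _ _ _ "\<lambda>y. y / g"]) auto
qed (use g_nz in auto)

lemma ch_K_trivial: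
  assumes "q - 1 dvd j" "c \<in> K" "c \<noteq> 0"
  shows "ch j c = 1"
proof -
  obtain m where m: "j = (q - 1) * m" using assms(1) by auto
  have "ch j c = ch m c ^ (q - 1)" by (simp add: m mult.commute flip: ch_mult_left)
  also have "\<dots> = ch m (c ^ (q - 1))" using assms by (simp add: ch_power)
  also have "\<dots> = 1" unfolding K_unit_power[OF assms(2,3)] by simp
  finally show ?thesis .
qed

lemma sum_ch_K:
  "(\<Sum>x\<in>K - {0}. ch j x) = (if q - 1 dvd j then of_nat (q - 1) else 0)"
proof (cases "q - 1 dvd j")
  case True
  hence "(\<Sum>x\<in>K - {0}. ch j x) = (\<Sum>x\<in>K - {0}. 1)"
    by (intro sum.cong refl ch_K_trivial) auto
  thus ?thesis using True K_closed by (simp add: card_Diff_singleton card_K)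
next
  case False
  \<comment> \<open>\<open>g ^ Q\<close> generates the units of \<open>K\<close>; there the
    character takes the value \<open>\<omega> ^ (j * Q)\<close>, which is \<open>1\<close> only if
    \<open>q - 1\<close> divides \<open>j\<close>.\<close>
  define c where "c = g ^ Q"
  have c: "c \<noteq> 0" using g_nz by (simp add: c_def)
  have "c ^ (q - 1) = 1"
    using power_N[OF g_nz] by (simp add: c_def N_eq power_mult)
  hence "c ^ q = c"
    using power_minus_mult[of q c] q_gt1 by simp
  hence cK: "c \<in> K" by (simp add: K_iff_power)
  have "(\<Sum>x\<in>K - {0}. ch j x) = 0"
  proof (rule sum_ch_subgroup)
    show "ch j c \<noteq> 1"
      using False Q_pos by (simp add: c_def ch_g_power omega_power_eq_1_iff N_eq mult.commute)
    show "bij_betw ((*) c) (K - {0}) (K - {0})"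
      using c cK K_closed
      by (intro bij_betwI[of _ _ _ "\<lambda>y. inverse c * y"]) (auto simp flip: mult.assoc)
  qed (use c cK in auto)
  thus ?thesis using False by simp
qed

section \<open>Character sums over trace fibres\<close>

definition U :: "'a \<Rightarrow> nat \<Rightarrow> complex" where
  "U b j = (\<Sum>y | Tr y = b. ch j y)"

text \<open>For \<open>t\<close> in \<open>K\<close> the second condition becomes
  \<open>t * b = b\<close>, which forces \<open>t = 1\<close>; outside \<open>K\<close> the two
  conditions are independent.\<close>

lemma card_Tr_ratio:
  assumes b: "b \<in> K" "b \<noteq> 0" and "t \<noteq> 0"
  shows "card {y. Tr y = b \<and> Tr (y * t) = b} =
    (if t = 1 then q ^ (n - 1) else if t \<in> K then 0 else q ^ (n - 2))"
proof -
  have "card {y. Tr y = b \<and> Tr (y * t) = b} = 0" if t: "t \<in> K" "t \<noteq> 1"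
  proof -
    have "Tr (y * t) = t * Tr y" for y
      using Tr_scale[OF t(1), of y] by (simp add: mult.commute)
    hence "{y. Tr y = b \<and> Tr (y * t) = b} = {}" using t b by auto
    thus ?thesis by simp
  qed
  thus ?thesis using b card_Tr_fibre[of b] card_Tr_pair_fibre[of t b b] by auto
qed

text \<open>Writing \<open>z = y t\<close> in \<open>\<Sum> ch j y * cnj (ch j z)\<close> turns the square of the norm into
  a character sum weighted by the numbers of \<open>card_Tr_ratio\<close>.\<close>
lemma norm_U_square:
  assumes b: "b \<in> K" "b \<noteq> 0" and j: "\<not> N dvd j"
  shows "(norm (U b j))\<^sup>2 = (if q - 1 dvd j then real q ^ (n - 2) else real q ^ (n - 1))"
proof -
  let ?S = "{y. Tr y = b}"
  let ?M = "\<lambda>t. card {y. Tr y = b \<and> Tr (y * t) = b}"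
  have nz: "y \<noteq> 0" if "Tr y = b" for y using that b Tr_0 by auto
  have inner: "(\<Sum>z\<in>?S. ch j y * cnj (ch j z)) =
      (\<Sum>t\<in>UNIV - {0}. if Tr (y * t) = b then cnj (ch j t) else 0)" if y: "Tr y = b" for y
  proof -
    have "(\<Sum>z\<in>?S. ch j y * cnj (ch j z)) =
        (\<Sum>z\<in>UNIV - {0}. if Tr z = b then ch j y * cnj (ch j z) else 0)"
      using nz by (subst sum.inter_filter[symmetric]) (auto intro!: sum.cong)
    also have "\<dots> = (\<Sum>t\<in>UNIV - {0}. if Tr (y * t) = b then ch j y * cnj (ch j (y * t)) else 0)"
      by (rule sum.reindex_bij_betw[symmetric, where h = "(*) y"],
          rule bij_betwI[of _ _ _ "\<lambda>z. z / y"]) (use nz[OF y] in auto)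
    also have "\<dots> = (\<Sum>t\<in>UNIV - {0}. if Tr (y * t) = b then cnj (ch j t) else 0)"
    proof (intro sum.cong refl if_cong)
      fix t :: 'a assume "t \<in> UNIV - {0}"
      thus "ch j y * cnj (ch j (y * t)) = cnj (ch j t)"
        using nz[OF y] ch_cnj_mult[of j y] by (simp add: ch_mult flip: mult.assoc)
    qed
    finally show ?thesis .
  qed
  have "complex_of_real ((norm (U b j))\<^sup>2) = U b j * cnj (U b j)"
    by (rule complex_norm_square)
  also have "\<dots> = (\<Sum>y\<in>?S. \<Sum>z\<in>?S. ch j y * cnj (ch j z))"
    by (simp add: U_def sum_product)
  also have "\<dots> = (\<Sum>y\<in>?S. \<Sum>t\<in>UNIV - {0}. if Tr (y * t) = b then cnj (ch j t) else 0)"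
    by (intro sum.cong refl inner) auto
  also have "\<dots> = (\<Sum>t\<in>UNIV - {0}. \<Sum>y\<in>?S. if Tr (y * t) = b then cnj (ch j t) else 0)"
    by (rule sum.swap)
  also have "\<dots> = (\<Sum>t\<in>UNIV - {0}. of_nat (?M t) * cnj (ch j t))"
    by (intro sum.cong refl) (simp add: sum.If_cases Collect_conj_eq)
  \<comment> \<open>Each count is the generic value \<open>q ^ (n - 2)\<close> with corrections at
    \<open>t = 1\<close> and on \<open>K\<close>, so the main sum runs over all units and vanishes,
    leaving only the corrections.\<close>
  also have "\<dots> = (\<Sum>t\<in>UNIV - {0}. of_nat (q ^ (n - 2)) * cnj (ch j t)
      + (if t = 1 then of_nat (q ^ (n - 1)) else 0)
      - (if t \<in> K then of_nat (q ^ (n - 2)) * cnj (ch j t) else 0))"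
    by (intro sum.cong refl) (use K_closed in \<open>auto simp: card_Tr_ratio[OF b]\<close>)
  also have "\<dots> = of_nat (q ^ (n - 2)) * cnj (\<Sum>t\<in>UNIV - {0}. ch j t) + of_nat (q ^ (n - 1))
      - of_nat (q ^ (n - 2)) * cnj (\<Sum>t\<in>K - {0}. ch j t)"
  proof -
    have "(\<Sum>t\<in>UNIV - {0}. if t \<in> K then of_nat (q ^ (n - 2)) * cnj (ch j t) else 0)
        = (\<Sum>t\<in>K - {0}. of_nat (q ^ (n - 2)) * cnj (ch j t))"
      by (subst sum.inter_filter[symmetric]) (auto intro!: sum.cong)
    thus ?thesis
      by (simp add: sum.distrib sum_subtractf sum_distrib_left sum.delta)
  qed
  also have "\<dots> = of_nat (q ^ (n - 1)) - of_nat (q ^ (n - 2)) * (if q - 1 dvd j then of_nat (q - 1) else 0)"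
    using j by (simp add: sum_ch_units sum_ch_K)
  also have "\<dots> = of_real (if q - 1 dvd j then real q ^ (n - 2) else real q ^ (n - 1))"
  proof -
    have "Suc (n - 2) = n - 1" using n_ge2 by simp
    hence "complex_of_nat q ^ (n - 1) = of_nat q ^ (n - 2) * of_nat q"
      by (metis power_Suc2)
    thus ?thesis using q_gt1 by (auto simp: of_nat_diff algebra_simps)
  qed
  finally show ?thesis by (simp only: of_real_eq_iff)
qed

lemma U_trivial: "b \<in> K \<Longrightarrow> U b 0 = of_nat (q ^ (n - 1))"
  by (simp add: U_def card_Tr_fibre)

end

subsection \<open>Squares with prescribed trace\<close>

text \<open>The congruence on \<open>q\<close> makes \<open>4\<close> divide \<open>N\<close>; the
  odd degree makes \<open>Q\<close> odd and the division \<open>(n - 1) div 2\<close> exact.\<close>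

locale square_trace = finite_field_extension +
  fixes \<beta> :: 'a
  assumes beta: "\<beta> \<in> K" "\<beta> \<noteq> 0" and q_mod4: "q mod 4 = 1" and odd_n: "odd n"
begin

definition V :: "'a set" where "V = {\<xi>. Tr (\<xi> ^ 2) = \<beta>}"

definition T :: "nat \<Rightarrow> complex" where "T j = (\<Sum>\<xi>\<in>V. ch j \<xi>)"

definition R :: real where "R = real q ^ ((n - 1) div 2)"

text \<open>Replaces the constant \<open>2\<close> in \<open>norm_T_le\<close> for characters
  trivial on \<open>K\<close>, where the bound on one of the two fibre sums shrinks by the factor
  \<open>sqrt q\<close>.\<close>

definition c :: real where "c = 1 + 1 / sqrt (real q)"

lemma V_nonzero: "\<xi> \<in> V \<Longrightarrow> \<xi> \<noteq> 0"
  using beta Tr_0 by (auto simp: V_def)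

lemma odd_Q: "odd Q"
proof -
  have "odd q" using q_mod4 by presburger
  hence "odd (\<Sum>i<m. q ^ i) \<longleftrightarrow> odd m" for m
    by (induction m) simp_all
  thus ?thesis using odd_n by (simp add: Q_eq_sum)
qed

lemma four_dvd_N: "4 dvd N"
proof -
  have "4 dvd q - 1" using q_mod4 by presburger
  thus ?thesis by (simp add: N_eq)
qed

lemma even_N: "even N"
  using four_dvd_N by presburger

lemma R_pos: "R > 0"
  using q_gt1 by (simp add: R_def)

lemma R_square: "R\<^sup>2 = real q ^ (n - 1)"
proof -
  have "(n - 1) div 2 * 2 = n - 1" using odd_n by presburger
  thus ?thesis by (simp add: R_def flip: power_mult)
qed

lemma c_bounds: "1 < c" "c < 2"
  using q_gt1 by (simp_all add: c_def divide_simps)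

lemma minus_one_neq_one: "(- 1 :: 'a) \<noteq> 1"
proof -
  have "(g ^ (N div 2)) ^ 2 = 1"
    using even_N power_N[OF g_nz] by (simp flip: power_mult)
  moreover have neq: "g ^ (N div 2) \<noteq> 1"
  proof
    assume "g ^ (N div 2) = 1"
    hence "[N div 2 = 0] (mod N)" using g_power_inj[of "N div 2" 0] by simp
    hence "N dvd N div 2" by (simp add: cong_0_iff)
    thus False using N_pos even_N by (auto dest!: dvd_imp_le)
  qed
  ultimately have "g ^ (N div 2) = - 1" by (simp add: power2_eq_1_iff)
  thus "(- 1 :: 'a) \<noteq> 1" using neq by simp
qed

text \<open>\<open>ch (N div 2)\<close> is the quadratic character: even powers of \<open>g\<close>
  have two square roots and odd powers none.\<close>

lemma card_square_roots:
  assumes "y \<noteq> 0"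
  shows "of_nat (card {\<xi>. \<xi> ^ 2 = y}) = 1 + ch (N div 2) y"
proof -
  obtain a where a: "y = g ^ a" using gen assms by blast
  show ?thesis
  proof (cases "even a")
    case True
    then obtain b where b: "a = 2 * b" by auto
    have "\<xi> ^ 2 = y \<longleftrightarrow> \<xi> = g ^ b \<or> \<xi> = - (g ^ b)" for \<xi>
      by (simp add: a b mult.commute[of 2] power_mult power2_eq_iff)
    hence "{\<xi>. \<xi> ^ 2 = y} = {g ^ b, - (g ^ b)}" by auto
    moreover have "g ^ b \<noteq> - (g ^ b)"
    proof
      assume "g ^ b = - (g ^ b)"
      hence "g ^ b * 1 = g ^ b * (- 1)" by simp
      thus False using g_nz minus_one_neq_one by (metis mult_left_cancel power_not_zero)
    qed
    moreover have "ch (N div 2) y = 1"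
      unfolding a ch_g_power omega_power_eq_1_iff b using even_N by (simp flip: mult.assoc)
    ultimately show ?thesis by simp
  next
    case False
    have "\<xi> ^ 2 \<noteq> y" for \<xi>
    proof
      assume \<xi>: "\<xi> ^ 2 = y"
      hence "\<xi> \<noteq> 0" using assms by auto
      then obtain d where d: "\<xi> = g ^ d" using gen by blast
      have "g ^ (2 * d) = g ^ a" using \<xi> by (simp add: a d mult.commute[of 2] power_mult)
      hence "[2 * d = a] (mod N)" by (rule g_power_inj)
      hence "[2 * d = a] (mod 2)" using even_N cong_dvd_modulus_nat by blast
      thus False using False by (simp add: cong_def odd_iff_mod_2_eq_one)
    qed
    moreover have "ch (N div 2) y = - 1"
    proof -
      have "(ch (N div 2) y) ^ 2 = ch N y"
        using even_N by (simp flip: ch_mult_left)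
      hence "(ch (N div 2) y) ^ 2 = 1" by (simp add: ch_N_dvd)
      moreover have "ch (N div 2) y \<noteq> 1"
      proof
        assume "ch (N div 2) y = 1"
        hence "N dvd N div 2 * a" by (simp add: a ch_g_power omega_power_eq_1_iff)
        hence "N div 2 * 2 dvd N div 2 * a" using even_N by simp
        moreover have "N div 2 \<noteq> 0" using N_pos even_N by auto
        ultimately have "2 dvd a" unfolding nat_mult_dvd_cancel_disj by simp
        thus False using False by simp
      qed
      ultimately show ?thesis by (simp add: power2_eq_1_iff)
    qed
    ultimately show ?thesis by simp
  qed
qed

text \<open>Write \<open>ch (2 * i) \<xi>\<close> as \<open>ch i (\<xi> ^ 2)\<close> and group by
  \<open>y = \<xi> ^ 2\<close>; the number of roots \<open>1 + ch (N div 2) y\<close> splits the sum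
  in two.\<close>

lemma T_even: "T (2 * i) = U \<beta> i + U \<beta> (i + N div 2)"
proof -
  let ?S = "{y. Tr y = \<beta>}"
  have nz: "y \<noteq> 0" if "Tr y = \<beta>" for y using that beta Tr_0 by auto
  have "T (2 * i) = (\<Sum>\<xi>\<in>V. ch i (\<xi> ^ 2))"
    unfolding T_def by (intro sum.cong refl) (simp add: ch_power V_nonzero mult.commute[of 2] ch_mult_left)
  also have "\<dots> = (\<Sum>y\<in>?S. \<Sum>\<xi> | \<xi> \<in> V \<and> \<xi> ^ 2 = y. ch i (\<xi> ^ 2))"
    by (rule sum.group[symmetric]) (auto simp: V_def)
  also have "\<dots> = (\<Sum>y\<in>?S. of_nat (card {\<xi>. \<xi> ^ 2 = y}) * ch i y)"
  proof (intro sum.cong refl)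
    fix y assume "y \<in> ?S"
    hence "{\<xi>. \<xi> \<in> V \<and> \<xi> ^ 2 = y} = {\<xi>. \<xi> ^ 2 = y}" by (auto simp: V_def)
    thus "(\<Sum>\<xi> | \<xi> \<in> V \<and> \<xi> ^ 2 = y. ch i (\<xi> ^ 2)) = of_nat (card {\<xi>. \<xi> ^ 2 = y}) * ch i y"
      by simp
  qed
  also have "\<dots> = (\<Sum>y\<in>?S. ch i y + ch (i + N div 2) y)"
    by (intro sum.cong refl) (simp add: card_square_roots nz ch_add algebra_simps)
  finally show ?thesis by (simp add: sum.distrib U_def)
qed

lemma norm_U_le:
  assumes "\<not> N dvd j"
  shows "norm (U \<beta> j) \<le> R"
proof -
  have "real q ^ (n - 2) \<le> real q ^ (n - 1)"
    using q_gt1 by (intro power_increasing) auto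
  hence "(norm (U \<beta> j))\<^sup>2 \<le> R\<^sup>2"
    unfolding R_square norm_U_square[OF beta assms] by simp
  thus ?thesis using R_pos by (simp add: power2_le_iff_abs_le)
qed

lemma norm_U_le_trivial:
  assumes "\<not> N dvd j" "q - 1 dvd j"
  shows "norm (U \<beta> j) \<le> R / sqrt (real q)"
proof -
  have "Suc (n - 2) = n - 1" using n_ge2 by simp
  hence "real q ^ (n - 1) = real q ^ (n - 2) * real q"
    by (metis power_Suc2)
  hence "(norm (U \<beta> j))\<^sup>2 = (R / sqrt (real q))\<^sup>2"
    using q_gt1 assms(2) unfolding norm_U_square[OF beta assms(1)] power_divide R_square by simp
  thus ?thesis using R_pos by (simp add: power2_le_iff_abs_le)
qed

text \<open>Both fibre sums from \<open>T_even\<close> have nontrivial characters, each bounded by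
  \<open>R\<close>. If \<open>q - 1\<close> divides \<open>j\<close>, one of the two characters is
  trivial on \<open>K\<close> and its bound drops to \<open>R / sqrt q\<close>.\<close>

lemma norm_T_le:
  assumes "even j" "\<not> N dvd j"
  shows "norm (T j) \<le> (if q - 1 dvd j then c * R else 2 * R)"
proof -
  obtain i where i: "j = 2 * i" using assms(1) by auto
  have nd1: "\<not> N dvd i" using assms(2) i by auto
  have dbl: "2 * (i + N div 2) = j + N" using even_N i by simp
  have nd2: "\<not> N dvd i + N div 2"
  proof
    assume "N dvd i + N div 2"
    hence "N dvd j + N" unfolding dbl[symmetric] by (rule dvd_mult)
    thus False using assms(2) by simp
  qed
  have le: "norm (T j) \<le> norm (U \<beta> i) + norm (U \<beta> (i + N div 2))"
    unfolding i T_even by (rule norm_triangle_ineq)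
  show ?thesis
  proof (cases "q - 1 dvd j")
    case False
    thus ?thesis using le norm_U_le[OF nd1] norm_U_le[OF nd2] by simp
  next
    case True
    \<comment> \<open>With \<open>j = (q - 1) * t\<close>, the divisible exponent is
      \<open>i\<close> if \<open>t\<close> is even and \<open>i + N div 2\<close> if
      \<open>t\<close> is odd, because \<open>t + Q\<close> is then even.\<close>
    have "q - 1 dvd i \<or> q - 1 dvd i + N div 2"
    proof -
      obtain t where t: "j = (q - 1) * t" using True by auto
      show ?thesis
      proof (cases "even t")
        case True
        then obtain t' where "t = 2 * t'" by auto
        hence "i = (q - 1) * t'" using t i by simp
        thus ?thesis by simp
      next
        case False
        hence "even (t + Q)" using odd_Q by simp
        then obtain t' where t': "t + Q = 2 * t'" by (rule evenE)
        have "2 * (i + N div 2) = (q - 1) * (t + Q)"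
          unfolding dbl by (simp add: t N_eq algebra_simps)
        hence "i + N div 2 = (q - 1) * t'" using t' by simp
        thus ?thesis by simp
      qed
    qed
    hence "norm (U \<beta> i) + norm (U \<beta> (i + N div 2)) \<le> R / sqrt (real q) + R"
      using norm_U_le[OF nd1] norm_U_le[OF nd2] norm_U_le_trivial[OF nd1] norm_U_le_trivial[OF nd2]
      by linarith
    thus ?thesis using le True by (simp add: c_def algebra_simps)
  qed
qed

lemma card_V_ge: "real (card V) \<ge> R\<^sup>2 - R"
proof -
  have nd: "\<not> N dvd N div 2"
    using N_pos even_N by (auto dest!: dvd_imp_le)
  have "of_nat (card V) = T 0" by (simp add: T_def)
  also have "\<dots> = of_nat (q ^ (n - 1)) + U \<beta> (N div 2)"
    using T_even[of 0] U_trivial[OF beta(1)] by simp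
  finally have "Re (of_nat (card V)) = Re (of_nat (q ^ (n - 1)) + U \<beta> (N div 2))" by simp
  hence "real (card V) = R\<^sup>2 + Re (U \<beta> (N div 2))"
    unfolding R_square by simp
  moreover have "\<bar>Re (U \<beta> (N div 2))\<bar> \<le> R"
    using abs_Re_le_cmod norm_U_le[OF nd] order_trans by blast
  ultimately show ?thesis by linarith
qed

section \<open>Detecting \<open>l\<close>-th powers by characters\<close>

definition pw :: "nat \<Rightarrow> 'a \<Rightarrow> bool" where "pw l \<xi> \<longleftrightarrow> (\<exists>\<zeta>. \<xi> = \<zeta> ^ l)"

text \<open>The sum is geometric in an \<open>l\<close>-th root of unity \<open>z\<close>, with
  \<open>z = 1\<close> exactly when \<open>l\<close> divides the logarithm of
  \<open>\<xi>\<close>.\<close>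

lemma sum_ch_eq_pw:
  assumes l: "prime l" "l dvd N" and "\<xi> \<noteq> 0"
  shows "(\<Sum>i<l. ch (i * (N div l)) \<xi>) = (if pw l \<xi> then of_nat l else 0)"
proof -
  obtain a where a: "\<xi> = g ^ a" using gen assms by blast
  have pw_iff: "pw l \<xi> \<longleftrightarrow> l dvd a"
  proof
    assume "pw l \<xi>"
    then obtain \<zeta> where \<zeta>: "\<xi> = \<zeta> ^ l" by (auto simp: pw_def)
    hence "\<zeta> \<noteq> 0" using assms(3) prime_gt_0_nat[OF l(1)] by auto
    then obtain d where "\<zeta> = g ^ d" using gen by blast
    hence "g ^ a = g ^ (d * l)" using \<zeta> a by (simp add: power_mult)
    hence "[a = d * l] (mod N)" by (rule g_power_inj)
    hence "[a = d * l] (mod l)" using l(2) cong_dvd_modulus_nat by blast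
    thus "l dvd a" by (simp add: cong_dvd_iff)
  next
    assume "l dvd a"
    then obtain d where "a = l * d" by auto
    hence "\<xi> = (g ^ d) ^ l" using a by (simp add: mult.commute flip: power_mult)
    thus "pw l \<xi>" by (auto simp: pw_def)
  qed
  define z where "z = \<omega> ^ (N div l * a)"
  have term_eq: "ch (i * (N div l)) \<xi> = z ^ i" for i
    by (simp add: a ch_g_power z_def mult_ac flip: power_mult)
  have z1: "z = 1 \<longleftrightarrow> l dvd a"
  proof -
    have "N div l \<noteq> 0" using l N_pos by (simp add: dvd_div_eq_0_iff)
    moreover have "z = 1 \<longleftrightarrow> N div l * l dvd N div l * a"
      unfolding z_def omega_power_eq_1_iff using l by simp
    ultimately show ?thesis by simp
  qed
  show ?thesis
  proof (cases "pw l \<xi>")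
    case True
    hence "z = 1" using pw_iff z1 by simp
    thus ?thesis using True by (simp add: term_eq)
  next
    case False
    hence zn: "z \<noteq> 1" using pw_iff z1 by simp
    have "z ^ l = \<omega> ^ (N div l * l * a)" unfolding z_def by (simp add: mult_ac flip: power_mult)
    also have "\<dots> = 1" unfolding omega_power_eq_1_iff using l by simp
    finally have zl: "z ^ l = 1" .
    have "(\<Sum>i<l. z ^ i) = 0"
      using zn zl geometric_sum[OF zn, of l] by simp
    thus ?thesis using False by (simp add: term_eq)
  qed
qed

definition ind :: "nat set \<Rightarrow> 'a \<Rightarrow> real" where
  "ind P \<xi> = (if \<exists>l\<in>P. pw l \<xi> then 0 else 1)"

text \<open>Twisted counts are needed because removing the \<open>l\<close>-th powers from an
  untwisted count introduces the characters of order \<open>l\<close>.\<close>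

definition F :: "nat set \<Rightarrow> nat \<Rightarrow> complex" where
  "F P j = (\<Sum>\<xi>\<in>V. ch j \<xi> * of_real (ind P \<xi>))"

definition nfree :: "nat set \<Rightarrow> real" where
  "nfree P = (\<Sum>\<xi>\<in>V. ind P \<xi>)"

lemma F_0: "F P 0 = of_real (nfree P)"
  by (simp add: F_def nfree_def)

text \<open>Being no \<open>l\<close>-th power has indicator \<open>1\<close> minus the average of
  the \<open>l\<close> characters of order dividing \<open>l\<close>; the trivial one is absorbed in
  the factor \<open>1 - 1 / l\<close>.\<close>

lemma F_insert:
  assumes l: "prime l" "l dvd N"
  shows "F (insert l P) j = of_real (1 - 1 / real l) * F P j
    - of_real (1 / real l) * (\<Sum>i=1..<l. F P (j + i * (N div l)))"
proof -
  have l0: "l > 0" using l prime_gt_0_nat by blast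
  have pt: "of_real (ind (insert l P) \<xi>) = of_real (ind P \<xi>) *
      (1 - of_real (1 / real l) * (1 + (\<Sum>i=1..<l. ch (i * (N div l)) \<xi>)))" if "\<xi> \<in> V" for \<xi>
  proof -
    have "1 + (\<Sum>i=1..<l. ch (i * (N div l)) \<xi>) = (\<Sum>i<l. ch (i * (N div l)) \<xi>)"
      using l0 by (simp add: lessThan_atLeast0 sum.atLeast_Suc_lessThan)
    also have "\<dots> = (if pw l \<xi> then of_nat l else 0)"
      using l V_nonzero[OF that] by (rule sum_ch_eq_pw)
    finally show ?thesis using l0 by (auto simp: ind_def)
  qed
  have "F (insert l P) j = (\<Sum>\<xi>\<in>V. of_real (1 - 1 / real l) * (ch j \<xi> * of_real (ind P \<xi>))
      - of_real (1 / real l) * (\<Sum>i=1..<l. ch (j + i * (N div l)) \<xi> * of_real (ind P \<xi>)))"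
    unfolding F_def
    by (intro sum.cong refl)
      (simp add: pt ch_add algebra_simps sum_distrib_left sum_distrib_right sum_divide_distrib)
  also have "\<dots> = of_real (1 - 1 / real l) * F P j
    - of_real (1 / real l) * (\<Sum>\<xi>\<in>V. \<Sum>i=1..<l. ch (j + i * (N div l)) \<xi> * of_real (ind P \<xi>))"
    by (simp only: sum_subtractf F_def sum_distrib_left)
  also have "(\<Sum>\<xi>\<in>V. \<Sum>i=1..<l. ch (j + i * (N div l)) \<xi> * of_real (ind P \<xi>))
      = (\<Sum>i=1..<l. F P (j + i * (N div l)))"
    unfolding F_def by (rule sum.swap)
  finally show ?thesis .
qed

end

subsection \<open>The sieve\<close>

context square_trace
begin

text \<open>\<open>j\<close> is the exponent of a character that is a square and has order prime to \<open>P\<close>.\<close>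
definition adm :: "nat set \<Rightarrow> nat \<Rightarrow> bool" where
  "adm P j \<longleftrightarrow> even j \<and> (\<exists>u. N dvd j * u \<and> (\<forall>l\<in>P. coprime u l))"

lemma adm_0: "adm P 0"
  by (auto simp: adm_def intro: exI[of _ 1])

lemma adm_mono: "adm P j \<Longrightarrow> P' \<subseteq> P \<Longrightarrow> adm P' j"
  by (auto simp: adm_def)

text \<open>A character of order prime to \<open>l\<close> is multiplied by one of order exactly
  \<open>l\<close>. The coprime orders prevent cancellation: the product is nontrivial, and it is
  trivial on \<open>K\<close> only if both factors are, the second being so exactly when
  \<open>l\<close> divides \<open>Q\<close>.\<close>

lemma adm_shift:
  assumes adm: "adm (insert l P) j" and l: "prime l" "l dvd N" "l \<notin> P"
    and P: "\<And>l'. l' \<in> P \<Longrightarrow> prime l'" and i: "i \<in> {1..<l}"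
  defines "j' \<equiv> j + i * (N div l)"
  shows "adm P j'" "\<not> N dvd j'" "q - 1 dvd j' \<longleftrightarrow> q - 1 dvd j \<and> l dvd Q"
proof -
  obtain u where u: "N dvd j * u" "coprime u l" "\<And>l'. l' \<in> P \<Longrightarrow> coprime u l'" and "even j"
    using adm by (auto simp: adm_def)
  define M where "M = N div l"
  have M: "N = M * l" using l by (simp add: M_def)
  have M0: "M > 0" using M N_pos by (cases M) auto
  have j': "j' = j + i * M" by (simp add: j'_def M_def)
  have li: "\<not> l dvd i" using i by (auto dest: dvd_imp_le)
  have lu: "\<not> l dvd i * u"
    using li u(2) l(1) by (metis coprime_commute coprime_absorb_left not_prime_unit prime_dvd_multD)
  \<comment> \<open>Shifted exponents must stay even; for \<open>l = 2\<close> this rests on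
    \<open>4\<close> dividing \<open>N\<close>.\<close>
  have "even M"
  proof (cases "l = 2")
    case True
    thus ?thesis using four_dvd_N M by auto
  next
    case False
    hence "odd l" using l(1) primes_dvd_imp_eq two_is_prime_nat by blast
    thus ?thesis using even_N M by simp
  qed
  hence "even j'" using \<open>even j\<close> by (simp add: j')
  moreover have "N dvd j' * (u * l)"
  proof -
    have "j' * (u * l) = j * u * l + i * u * N" by (simp add: j' M algebra_simps)
    thus ?thesis using u(1) by simp
  qed
  moreover have "coprime (u * l) l'" if "l' \<in> P" for l'
    using u(3)[OF that] primes_coprime[OF l(1) P[OF that]] l(3) that by auto
  ultimately show "adm P j'" by (auto simp: adm_def)
  show "\<not> N dvd j'"
  proof
    assume "N dvd j'"
    hence "N dvd j' * u" by simp
    hence "N dvd j * u + i * u * M" by (simp add: j' algebra_simps)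
    hence "N dvd i * u * M" using u(1) by (simp only: dvd_add_right_iff)
    hence "l dvd i * u" using M M0 by (simp add: mult.commute[of M])
    thus False using lu by simp
  qed
  show "q - 1 dvd j' \<longleftrightarrow> q - 1 dvd j \<and> l dvd Q"
  proof
    assume a: "q - 1 dvd j \<and> l dvd Q"
    then obtain Q' where Q': "Q = l * Q'" by auto
    have "M = Q' * (q - 1)"
      using N_eq prime_gt_0_nat[OF l(1)] unfolding M Q' by simp
    thus "q - 1 dvd j'" using a by (simp add: j')
  next
    assume a: "q - 1 dvd j'"
    hence "q - 1 dvd j' * l" by simp
    hence "q - 1 dvd j * l + i * N" by (simp add: j' M algebra_simps)
    hence jl: "q - 1 dvd j * l" by (simp add: N_eq dvd_add_left_iff)
    have ju: "q - 1 dvd j * u" using u(1) N_eq dvd_trans dvd_triv_right by metis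
    \<comment> \<open>As \<open>u\<close> and \<open>l\<close> are coprime, this gcd is
      \<open>j\<close>.\<close>
    have "q - 1 dvd gcd (j * l) (j * u)" using jl ju by simp
    hence qj: "q - 1 dvd j"
      using u(2) by (simp add: gcd_mult_distrib_nat[symmetric] coprime_commute)
    hence "q - 1 dvd i * M" using a by (simp add: j' dvd_add_right_iff)
    hence "l * (q - 1) dvd i * M * l" by (simp add: mult.commute)
    hence "l * (q - 1) dvd i * Q * (q - 1)" using M N_eq by (simp add: mult.assoc)
    hence "l dvd i * Q" using q_gt1 by simp
    hence "l dvd Q" using l(1) li prime_dvd_multD by blast
    thus "q - 1 dvd j \<and> l dvd Q" using qj by simp
  qed
qed

definition \<theta> :: "nat set \<Rightarrow> real" where "\<theta> P = (\<Prod>l\<in>P. 1 - 1 / real l)"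

definition WQ :: "nat set \<Rightarrow> real" where "WQ P = 2 ^ card {l\<in>P. l dvd Q}"

text \<open>\<open>t\<close> records whether the character is trivial on \<open>K\<close>. Each
  subset of \<open>P\<close> contributes \<open>2\<close>; if \<open>t\<close> holds, subsets of
  primes dividing \<open>Q\<close> contribute only \<open>c\<close>, a saving of
  \<open>2 - c\<close> each.\<close>

definition err :: "nat set \<Rightarrow> bool \<Rightarrow> real" where
  "err P t = \<theta> P * R * (2 * 2 ^ card P - (if t then (2 - c) * WQ P else 0))"

lemma prime_factor_weight: "prime l \<Longrightarrow> 0 < 1 - 1 / real l"
  using prime_gt_1_nat[of l] by simp

text \<open>This recursion mirrors \<open>F_insert\<close>: the second summand bounds the shifted
  characters, which stay trivial on \<open>K\<close> only when \<open>l\<close> divides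
  \<open>Q\<close>.\<close>

lemma err_insert:
  assumes "finite P" "l \<notin> P"
  shows "err (insert l P) t = (1 - 1 / real l) * (err P t + err P (t \<and> l dvd Q))"
proof -
  have "{x \<in> insert l P. x dvd Q} = (if l dvd Q then insert l {x \<in> P. x dvd Q} else {x \<in> P. x dvd Q})"
    by auto
  hence "WQ (insert l P) = (if l dvd Q then 2 * WQ P else WQ P)"
    using assms by (simp add: WQ_def)
  thus ?thesis using assms by (simp add: err_def \<theta>_def algebra_simps)
qed

text \<open>The \<open>l - 1\<close> shifts weighted by \<open>1 / l\<close> carry total weight
  \<open>1 - 1 / l\<close>, the same as the unshifted term.\<close>

lemma shifted_sum_bound:
  assumes l: "prime l" "l dvd N" "l \<notin> P" and P: "\<And>l'. l' \<in> P \<Longrightarrow> prime l'"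
    and adm: "adm (insert l P) j"
    and bound: "\<And>j. adm P j \<Longrightarrow> \<not> N dvd j \<Longrightarrow> norm (F P j) \<le> err P (q - 1 dvd j)"
  shows "norm (of_real (1 / real l) * (\<Sum>i=1..<l. F P (j + i * (N div l))))
    \<le> (1 - 1 / real l) * err P (q - 1 dvd j \<and> l dvd Q)"
proof -
  let ?e = "err P (q - 1 dvd j \<and> l dvd Q)"
  have "norm (F P (j + i * (N div l))) \<le> ?e" if i: "i \<in> {1..<l}" for i
    using bound[of "j + i * (N div l)"] adm_shift[OF adm l _ i] P by simp
  hence "norm (\<Sum>i=1..<l. F P (j + i * (N div l))) \<le> real (card {1..<l}) * ?e"
    by (rule sum_norm_bound)
  hence "norm (\<Sum>i=1..<l. F P (j + i * (N div l))) \<le> (real l - 1) * ?e"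
    using prime_gt_1_nat[OF l(1)] by (simp add: of_nat_diff)
  thus ?thesis
    using prime_gt_0_nat[OF l(1)] by (simp add: norm_mult norm_divide field_simps)
qed

text \<open>Induction along \<open>F_insert\<close> and \<open>err_insert\<close>, starting from
  \<open>norm_T_le\<close>; admissibility keeps every shifted exponent even and nontrivial.\<close>

lemma norm_F_le:
  assumes "finite P" "\<And>l. l \<in> P \<Longrightarrow> prime l \<and> l dvd N" "adm P j" "\<not> N dvd j"
  shows "norm (F P j) \<le> err P (q - 1 dvd j)"
  using assms
proof (induction P arbitrary: j rule: finite_induct)
  case empty
  have "F {} j = T j" by (simp add: F_def T_def ind_def)
  moreover have "even j" using empty by (simp add: adm_def)
  ultimately show ?case
    using norm_T_le[of j] empty
    by (auto simp: err_def \<theta>_def WQ_def algebra_simps split: if_splits)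
next
  case (insert l P)
  have l: "prime l" "l dvd N" "l \<notin> P" using insert by auto
  have P: "\<And>l'. l' \<in> P \<Longrightarrow> prime l'" using insert by auto
  have bound: "norm (F P j) \<le> err P (q - 1 dvd j)" if "adm P j" "\<not> N dvd j" for j
    using insert that by auto
  have "norm (F (insert l P) j) \<le> norm (of_real (1 - 1 / real l) * F P j)
      + norm (of_real (1 / real l) * (\<Sum>i=1..<l. F P (j + i * (N div l))))"
    unfolding F_insert[OF l(1,2)] by (rule norm_triangle_ineq4)
  also have "norm (of_real (1 - 1 / real l) * F P j) = (1 - 1 / real l) * norm (F P j)"
    using prime_factor_weight[OF l(1)] unfolding norm_mult norm_of_real by simp
  also have "\<dots> \<le> (1 - 1 / real l) * err P (q - 1 dvd j)"
    using prime_factor_weight[OF l(1)] bound[OF adm_mono[OF insert.prems(2)] insert.prems(3)]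
    by (intro mult_left_mono) auto
  also note shifted_sum_bound[OF l P insert.prems(2) bound]
  finally show ?case
    by (simp add: err_insert insert.hyps distrib_left)
qed

text \<open>Only the shifted terms of \<open>F_insert\<close> at exponent \<open>0\<close> are
  estimated; \<open>nfree P\<close> is kept intact, so that the sieve can combine it across
  different \<open>l\<close>.\<close>

lemma nfree_insert:
  assumes P: "finite P" "\<And>l. l \<in> P \<Longrightarrow> prime l \<and> l dvd N" and l: "prime l" "l dvd N" "l \<notin> P"
  shows "nfree (insert l P) \<ge> (1 - 1 / real l) * (nfree P - err P (l dvd Q))"
proof -
  have prm: "\<And>l'. l' \<in> P \<Longrightarrow> prime l'" using P by auto
  let ?X = "of_real (1 / real l) * (\<Sum>i=1..<l. F P (0 + i * (N div l)))"
  have "of_real (nfree (insert l P)) = of_real (1 - 1 / real l) * of_real (nfree P) - ?X"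
    using F_insert[OF l(1,2), of P 0] unfolding F_0 .
  hence "nfree (insert l P) = (1 - 1 / real l) * nfree P - Re ?X"
    by (metis Re_complex_of_real minus_complex.sel(1) of_real_mult)
  moreover have "norm ?X \<le> (1 - 1 / real l) * err P (l dvd Q)"
    using shifted_sum_bound[OF l prm adm_0 norm_F_le[OF P]] by simp
  ultimately show ?thesis
    using abs_Re_le_cmod[of ?X] unfolding right_diff_distrib by linarith
qed

lemma nfree_ge:
  assumes "finite P" "\<And>l. l \<in> P \<Longrightarrow> prime l \<and> l dvd N"
  shows "nfree P \<ge> \<theta> P * R\<^sup>2 - err P True"
  using assms
proof (induction P rule: finite_induct)
  case empty
  have "nfree {} \<ge> R\<^sup>2 - R" using card_V_ge by (simp add: nfree_def ind_def)
  \<comment> \<open>\<open>err {} True\<close> equals \<open>c * R\<close>, so the sharper bound by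
    \<open>R\<close> is relaxed.\<close>
  moreover have "R \<le> c * R" using c_bounds R_pos by simp
  ultimately show ?case by (simp add: err_def \<theta>_def WQ_def algebra_simps)
next
  case (insert l P)
  have l: "prime l" "l dvd N" "l \<notin> P" using insert by auto
  have P: "\<And>l'. l' \<in> P \<Longrightarrow> prime l' \<and> l' dvd N" using insert by auto
  have "\<theta> (insert l P) * R\<^sup>2 - err (insert l P) True
      = (1 - 1 / real l) * ((\<theta> P * R\<^sup>2 - err P True) - err P (l dvd Q))"
    unfolding err_insert[OF insert.hyps] using insert.hyps by (simp add: \<theta>_def algebra_simps)
  also have "\<dots> \<le> (1 - 1 / real l) * (nfree P - err P (l dvd Q))"
    using prime_factor_weight[OF l(1)] insert.IH[OF P] by (intro mult_left_mono) auto
  also have "\<dots> \<le> nfree (insert l P)"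
    using insert.hyps P l by (intro nfree_insert) auto
  finally show ?case .
qed

text \<open>If \<open>\<xi>\<close> survives \<open>P\<close> and is an \<open>l\<close>-th power
  for some \<open>l\<close> in \<open>S\<close>, at most \<open>card S - 1\<close> summands are
  \<open>1\<close> and the right side is nonpositive; in the other cases both sides agree
  pointwise.\<close>

lemma nfree_sieve:
  assumes "finite S" "finite P"
  shows "nfree (P \<union> S) \<ge> (\<Sum>l\<in>S. nfree (insert l P)) - (real (card S) - 1) * nfree P"
proof -
  have pt: "ind (P \<union> S) \<xi> \<ge> (\<Sum>l\<in>S. ind (insert l P) \<xi>) - (real (card S) - 1) * ind P \<xi>" for \<xi>
  proof (cases "\<exists>l\<in>P. pw l \<xi>")
    case True
    hence "(\<Sum>l\<in>S. ind (insert l P) \<xi>) = 0"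
      by (intro sum.neutral) (auto simp: ind_def)
    thus ?thesis using True by (auto simp: ind_def)
  next
    case False
    show ?thesis
    proof (cases "\<exists>l\<in>S. pw l \<xi>")
      case True
      then obtain l where l: "l \<in> S" "pw l \<xi>" by blast
      have "(\<Sum>l\<in>S. ind (insert l P) \<xi>) = (\<Sum>l\<in>S - {l}. ind (insert l P) \<xi>)"
        using l assms(1) by (subst sum.remove[of _ l]) (auto simp: ind_def)
      also have "\<dots> \<le> (\<Sum>l\<in>S - {l}. 1)" by (intro sum_mono) (auto simp: ind_def)
      also have "\<dots> = real (card S) - 1"
        using l assms(1) card_gt_0_iff[of S] by (auto simp: card_Diff_singleton of_nat_diff)
      finally show ?thesis using False by (auto simp: ind_def)
    next
      case no: False
      hence "(\<Sum>l\<in>S. ind (insert l P) \<xi>) = (\<Sum>l\<in>S. 1)"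
        using False by (intro sum.cong) (auto simp: ind_def)
      moreover have "ind (P \<union> S) \<xi> = 1" "ind P \<xi> = 1"
        using no False by (auto simp: ind_def)
      ultimately show ?thesis by simp
    qed
  qed
  have "(\<Sum>l\<in>S. nfree (insert l P)) - (real (card S) - 1) * nfree P
      = (\<Sum>\<xi>\<in>V. (\<Sum>l\<in>S. ind (insert l P) \<xi>) - (real (card S) - 1) * ind P \<xi>)"
    unfolding nfree_def by (subst sum.swap) (simp add: sum_subtractf sum_distrib_left)
  also have "\<dots> \<le> (\<Sum>\<xi>\<in>V. ind (P \<union> S) \<xi>)"
    by (intro sum_mono pt)
  finally show ?thesis by (simp add: nfree_def)
qed

text \<open>As \<open>\<delta>\<close> equals the sum of \<open>1 - 1 / l\<close> over
  \<open>S\<close> minus \<open>card S - 1\<close>, the sieve bound is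
  \<open>\<delta> * nfree P\<close> plus the differences
  \<open>nfree (insert l P) - (1 - 1 / l) * nfree P\<close>. The former is bounded by
  \<open>nfree_ge\<close>, the latter by \<open>nfree_insert\<close>.\<close>

lemma nfree_pos:
  fixes P S
  defines "\<delta> \<equiv> 1 - (\<Sum>l\<in>S. 1 / real l)"
  assumes fin: "finite P" "finite S" and disj: "P \<inter> S = {}"
    and prm: "\<And>l. l \<in> P \<union> S \<Longrightarrow> prime l \<and> l dvd N"
    and \<delta>: "\<delta> > 0"
    and main: "\<delta> * R > 2 * (real (card S) - 1 + 2 * \<delta>) * 2 ^ card P
      - (2 - c) * ((\<Sum>l | l \<in> S \<and> l dvd Q. 1 - 1 / real l) + \<delta>) * WQ P"
  shows "nfree (P \<union> S) > 0"
proof -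
  let ?w = "\<lambda>l::nat. 1 - 1 / real l"
  have sumw: "(\<Sum>l\<in>S. ?w l) = real (card S) - 1 + \<delta>"
    by (simp add: \<delta>_def sum_subtractf)
  have th: "\<theta> P > 0"
    unfolding \<theta>_def by (intro prod_pos prime_factor_weight) (use prm in auto)
  \<comment> \<open>\<open>\<theta> P * R\<close> times the margin in the criterion
    \<open>main\<close>.\<close>
  let ?B = "\<theta> P * R * (\<delta> * R - (2 * (real (card S) - 1 + 2 * \<delta>) * 2 ^ card P
      - (2 - c) * ((\<Sum>l | l \<in> S \<and> l dvd Q. ?w l) + \<delta>) * WQ P))"
  have "0 < ?B" using th R_pos main by simp
  also have "?B = \<delta> * (\<theta> P * R\<^sup>2 - err P True) - (\<Sum>l\<in>S. ?w l * err P (l dvd Q))"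
  proof -
    have "w * err P t = \<theta> P * R * 2 * 2 ^ card P * w
        - \<theta> P * R * (2 - c) * WQ P * (if t then w else 0)" for w t
      by (simp add: err_def algebra_simps)
    hence "(\<Sum>l\<in>S. ?w l * err P (l dvd Q))
        = (\<Sum>l\<in>S. \<theta> P * R * 2 * 2 ^ card P * ?w l
            - \<theta> P * R * (2 - c) * WQ P * (if l dvd Q then ?w l else 0))"
      by (simp only:)
    also have "\<dots> = \<theta> P * R * 2 * 2 ^ card P * (\<Sum>l\<in>S. ?w l)
        - \<theta> P * R * (2 - c) * WQ P * (\<Sum>l\<in>S. if l dvd Q then ?w l else 0)"
      by (subst sum_subtractf) (simp only: sum_distrib_left)
    also have "(\<Sum>l\<in>S. if l dvd Q then ?w l else 0) = (\<Sum>l | l \<in> S \<and> l dvd Q. ?w l)"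
      using fin by (subst sum.inter_filter[symmetric]) auto
    finally show ?thesis
      unfolding sumw err_def by (simp add: algebra_simps power2_eq_square)
  qed
  also have "\<dots> \<le> \<delta> * nfree P - (\<Sum>l\<in>S. ?w l * err P (l dvd Q))"
    using \<delta> nfree_ge[of P] fin prm by (intro diff_right_mono mult_left_mono) auto
  also have "\<dots> = (\<Sum>l\<in>S. ?w l * (nfree P - err P (l dvd Q))) - (real (card S) - 1) * nfree P"
    unfolding right_diff_distrib sum_subtractf sum_distrib_right[symmetric]
    by (simp add: algebra_simps \<delta>_def)
  also have "\<dots> \<le> (\<Sum>l\<in>S. nfree (insert l P)) - (real (card S) - 1) * nfree P"
    by (intro diff_right_mono sum_mono nfree_insert) (use fin prm disj in auto)
  also have "\<dots> \<le> nfree (P \<union> S)"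
    using fin by (intro nfree_sieve) auto
  finally show ?thesis .
qed

text \<open>Checking primes suffices: a \<open>d\<close>-th power with \<open>d\<close> other than
  \<open>1\<close> is an \<open>l\<close>-th power for any prime \<open>l\<close> dividing
  \<open>d\<close>.\<close>

lemma nfree_imp_num_free:
  assumes "nfree (prime_factors N) > 0"
  shows "num_free q n \<beta> N > 0"
proof -
  obtain \<xi> where \<xi>: "\<xi> \<in> V" "ind (prime_factors N) \<xi> > 0"
    using assms sum_nonpos[of V "ind (prime_factors N)"] unfolding nfree_def
    by (meson not_less)
  hence npw: "\<not> pw l \<xi>" if "l \<in> prime_factors N" for l
    using that by (auto simp: ind_def split: if_splits)
  have "m_free N \<xi>"
    unfolding m_free_def
  proof (intro allI impI)
    fix d \<zeta> assume d: "d dvd N" "\<xi> = \<zeta> ^ d"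
    show "d = 1"
    proof (rule ccontr)
      assume "d \<noteq> 1"
      then obtain l where l: "prime l" "l dvd d" using prime_factor_nat by blast
      then obtain e where "d = e * l" by (metis dvdE mult.commute)
      hence "pw l \<xi>" using d(2) by (auto simp: pw_def power_mult)
      moreover have "l \<in> prime_factors N"
        using l d(1) N_pos by (auto simp: prime_factors_dvd intro: dvd_trans)
      ultimately show False using npw by blast
    qed
  qed
  hence "\<xi> \<in> {\<xi>. \<xi> \<noteq> 0 \<and> m_free N \<xi> \<and> Tr (\<xi> ^ 2) = \<beta>}"
    using \<xi> V_nonzero by (auto simp: V_def)
  thus ?thesis unfolding num_free_def by (subst card_gt_0_iff) auto
qed

end

subsection \<open>Comparison with the stated criterion\<close>

lemma prime_factors_prod_primes:
  assumes "finite A" "\<And>l. l \<in> A \<Longrightarrow> prime (l :: nat)"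
  shows "prime_factors (\<Prod>A) = A"
proof -
  have "prime_factors (prod (\<lambda>l. l) A) = \<Union>((prime_factors \<circ> (\<lambda>l. l)) ` A)"
    using assms by (intro prime_factors_prod) (auto dest: prime_gt_0_nat)
  also have "\<dots> = A" using assms by (auto simp: prime_prime_factors)
  finally show ?thesis by simp
qed

lemma prod_primes_dvd:
  assumes "finite A" "\<And>l. l \<in> A \<Longrightarrow> prime (l :: nat) \<and> l dvd m"
  shows "\<Prod>A dvd m"
  using assms
proof (induction A rule: finite_induct)
  case (insert l A)
  have "coprime l (\<Prod>A)"
    using insert by (intro prod_coprime_right primes_coprime) auto
  moreover have "l dvd m" "\<Prod>A dvd m" using insert by auto
  ultimately show ?case using insert.hyps by (simp add: divides_mult)
qed simp

text \<open>The order of \<open>q\<close> modulo \<open>l\<close> divides the prime \<open>n\<close>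
  and is not \<open>1\<close>, so it is \<open>n\<close>; hence \<open>n\<close>, and by parity
  \<open>2 * n\<close>, divides \<open>l - 1\<close>.\<close>

lemma cyclotomic_prime_factor_ge:
  fixes q n l :: nat
  assumes "prime n" "odd n" "prime l" "odd l" "[q ^ n = 1] (mod l)" "\<not> [q = 1] (mod l)"
  shows "2 * n + 1 \<le> l"
proof -
  have "ord l q dvd n" using assms(5) by (simp only: ord_divides)
  moreover have "ord l q \<noteq> 1" using assms(6) ord_divides[of q 1 l] by auto
  ultimately have "ord l q = n" using assms(1) by (auto simp: prime_nat_iff)
  moreover have "coprime l q"
  proof (rule ccontr)
    assume "\<not> coprime l q"
    hence "l dvd q" using assms(3) prime_imp_coprime by blast
    hence "[q ^ n = 0] (mod l)"
      using assms(1) prime_gt_0_nat[of n] by (simp add: cong_0_iff dvd_power_iff_le dvd_power dvd_trans)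
    hence "[1 = 0] (mod l)" using assms(5) cong_sym cong_trans by blast
    thus False using assms(3) by (simp add: cong_0_iff)
  qed
  ultimately have "n dvd l - 1"
    using order_divides_totient[of l q] assms(3) by (simp add: totient_prime)
  moreover have "2 dvd l - 1" using assms(4) by simp
  moreover have "coprime 2 n" using assms(2) by simp
  ultimately have "2 * n dvd l - 1" by (simp add: divides_mult)
  moreover have "l > 1" using assms(3) by (rule prime_gt_1_nat)
  ultimately show ?thesis by (auto dest!: dvd_imp_le)
qed

lemma pow_2_ge_linear: "7 \<le> r \<Longrightarrow> 8 * (r + 1) \<le> (2::nat) ^ r"
  by (induction r rule: dec_induct) auto

context square_trace
begin

lemma WQ_le: "finite P \<Longrightarrow> WQ P \<le> 2 ^ card P"
  unfolding WQ_def by (intro power_increasing card_mono) auto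

text \<open>Here \<open>q - 1 = 4\<close>, so a prime modulo which \<open>q\<close> is
  \<open>1\<close> would be \<open>2\<close>, which does not divide the odd
  \<open>Q\<close>.\<close>

lemma Q_prime_large:
  assumes "q = 5" "prime n" "prime l" "l dvd Q"
  shows "2 * n + 1 \<le> l"
proof (rule cyclotomic_prime_factor_ge[of n l q])
  show odd: "odd l" using assms odd_Q dvd_trans by blast
  have "l dvd q ^ n - 1" using assms(4) N_eq unfolding N_def by simp
  thus "[q ^ n = 1] (mod l)"
    using q_pow_gt1 by (subst cong_altdef_nat) auto
  show "\<not> [q = 1] (mod l)"
  proof
    assume "[q = 1] (mod l)"
    hence "l dvd 2 ^ 2" using assms(1) by (simp add: cong_altdef_nat)
    hence "l dvd 2" using assms(3) prime_dvd_power by blast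
    hence "l = 2" using assms(3) primes_dvd_imp_eq two_is_prime_nat by blast
    thus False using odd by simp
  qed
qed (use assms odd_n in auto)

text \<open>The leftover case: for \<open>q = 5\<close> and \<open>2 \<in> S\<close> the characters trivial on \<open>K\<close> are not absorbed by
  the factor \<open>sqrt 2\<close>, but every prime factor of \<open>Q\<close> exceeds \<open>2 n\<close>, so there are few of them and
  the sieve criterion holds outright.\<close>
lemma many_sieving_primes:
  assumes q5: "q = 5" and n: "prime n"
    and fin: "finite P" "finite S" and disj: "P \<inter> S = {}" and PS: "P \<union> S = prime_factors N"
    and two: "2 \<in> S" and many: "7 \<le> card {l\<in>S. l dvd Q}"
  defines "\<delta> \<equiv> 1 - (\<Sum>l\<in>S. 1 / real l)"
  shows "\<delta> * R > 2 * (real (card S) - 1 + 2 * \<delta>) * 2 ^ card P"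
proof -
  define SQ where "SQ = {l\<in>S. l dvd Q}"
  define r where "r = card SQ"
  define t where "t = card P"
  define m where "m = (n - 1) div 2"
  have prm: "prime l" "l = 2 \<or> l dvd Q" if l: "l \<in> P \<union> S" for l
  proof -
    show pl: "prime l" using l PS by auto
    have "l dvd N" using l PS by auto
    hence "l dvd Q * 2 ^ 2" using N_eq q5 by simp
    hence "l dvd Q \<or> l dvd 2"
      using pl prime_dvd_multD prime_dvd_power by blast
    thus "l = 2 \<or> l dvd Q" using pl primes_dvd_imp_eq two_is_prime_nat by blast
  qed
  have two_ndvd: "\<not> 2 dvd Q" using odd_Q by simp
  have S: "S = insert 2 SQ" using two prm by (auto simp: SQ_def)
  have SQ2: "2 \<notin> SQ" using two_ndvd by (simp add: SQ_def)
  have finSQ: "finite SQ" using fin by (simp add: SQ_def)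
  have PQ: "l dvd Q" if "l \<in> P" for l using prm[of l] that two disj by auto
  have large: "2 * n + 1 \<le> l" if "l \<in> P \<union> SQ" for l
    using that prm PQ by (intro Q_prime_large q5 n) (auto simp: SQ_def)
  have cardPS: "card (P \<union> SQ) = t + r"
    unfolding t_def r_def using fin finSQ disj by (intro card_Un_disjoint) (auto simp: SQ_def)
  \<comment> \<open>The \<open>t + r\<close> primes of \<open>P\<close> and \<open>SQ\<close> are
    distinct divisors of \<open>Q\<close>, each at least \<open>2 * n + 1\<close>, so their product
    bounds \<open>Q\<close> from below.\<close>
  have "(2 * n + 1) ^ (t + r) = (\<Prod>l\<in>P \<union> SQ. 2 * n + 1)"
    by (simp add: cardPS)
  also have "\<dots> \<le> \<Prod>(P \<union> SQ)"
    using large by (intro prod_mono) auto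
  also have "\<dots> \<le> Q"
    using fin finSQ prm PQ Q_pos by (intro dvd_imp_le prod_primes_dvd) (auto simp: SQ_def)
  also have "\<dots> \<le> N" using N_eq q5 by simp
  also have "\<dots> \<le> q ^ n" by (simp add: N_def)
  finally have pow: "(2 * n + 1) ^ (t + r) \<le> 5 ^ n" unfolding q5 .
  have r7: "7 \<le> r" using many by (simp add: r_def SQ_def)
  \<comment> \<open>Seven such primes already have a product above \<open>5 ^ n\<close> for
    \<open>n\<close> up to \<open>11\<close>.\<close>
  have n12: "12 \<le> n"
  proof (rule ccontr)
    assume "\<not> 12 \<le> n"
    hence "n \<in> {2..11}" using n_ge2 by auto
    have "(2 * n + 1) ^ 7 \<le> (2 * n + 1) ^ (t + r)"
      using r7 by (intro power_increasing) auto
    hence *: "(2 * n + 1) ^ 7 \<le> 5 ^ n" using pow by linarith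
    have "n = 2 \<or> n = 3 \<or> n = 4 \<or> n = 5 \<or> n = 6 \<or> n = 7 \<or> n = 8 \<or> n = 9 \<or> n = 10 \<or> n = 11"
      using \<open>n \<in> {2..11}\<close> unfolding atLeastAtMost_iff by presburger
    thus False using * by (elim disjE) simp_all
  qed
  \<comment> \<open>From \<open>n \<ge> 12\<close> on, each factor is at least
    \<open>25 = 5 ^ 2\<close>, so \<open>2 * (t + r) \<le> n\<close>; odd \<open>n\<close> then
    gives \<open>t + r \<le> m\<close>.\<close>
  have "(5::nat) ^ (2 * (t + r)) = 25 ^ (t + r)" unfolding power_mult by simp
  also have "\<dots> \<le> (2 * n + 1) ^ (t + r)" using n12 by (intro power_mono) auto
  also have "\<dots> \<le> 5 ^ n" by (rule pow)
  finally have "2 * (t + r) \<le> n" by (simp add: power_increasing_iff)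
  hence tr: "t + r \<le> m" using odd_n unfolding m_def by presburger
  have sumS: "(\<Sum>l\<in>S. 1 / real l) = 1 / 2 + (\<Sum>l\<in>SQ. 1 / real l)"
    using finSQ SQ2 by (simp add: S)
  have "(\<Sum>l\<in>SQ. 1 / real l) \<le> real (card SQ) * (1 / real (2 * n + 1))"
  proof (rule sum_bounded_above)
    fix l assume "l \<in> SQ"
    hence "real (2 * n + 1) \<le> real l" using large by (intro of_nat_mono) auto
    thus "1 / real l \<le> 1 / real (2 * n + 1)" by (intro frac_le) auto
  qed
  also have "\<dots> \<le> 1 / 4"
    using \<open>2 * (t + r) \<le> n\<close> by (simp add: r_def field_simps)
  finally have \<delta>4: "\<delta> \<ge> 1 / 4" unfolding \<delta>_def sumS by simp
  have \<delta>2: "\<delta> \<le> 1 / 2" unfolding \<delta>_def sumS by (simp add: sum_nonneg)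
  have "card S = r + 1" using finSQ SQ2 by (simp add: S r_def)
  hence "2 * (real (card S) - 1 + 2 * \<delta>) * 2 ^ card P \<le> 2 * (real r + 1) * 2 ^ t"
    using \<delta>2 unfolding t_def by (intro mult_right_mono mult_left_mono) auto
  \<comment> \<open>The factor \<open>1 / 4\<close> is split off to match
    \<open>\<delta> \<ge> 1 / 4\<close>; \<open>2 ^ r\<close> absorbs the rest.\<close>
  also have "\<dots> = (1 / 4) * (real (8 * (r + 1)) * 2 ^ t)" by simp
  also have "\<dots> \<le> (1 / 4) * (real (2 ^ r) * 2 ^ t)"
    using pow_2_ge_linear[OF r7] by (intro mult_left_mono mult_right_mono) (simp_all only: of_nat_le_iff, auto)
  also have "\<dots> = (1 / 4) * 2 ^ (t + r)" by (simp add: power_add)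
  also have "\<dots> \<le> (1 / 4) * 2 ^ m" using tr by simp
  also have "\<dots> < (1 / 4) * 5 ^ m"
    using tr r7 by (intro mult_strict_left_mono power_strict_mono) auto
  also have "\<dots> = (1 / 4) * R" by (subst R_def) (simp add: m_def q5)
  also have "\<dots> \<le> \<delta> * R" using \<delta>4 R_pos by (intro mult_right_mono) auto
  finally show ?thesis .
qed

text \<open>For \<open>q \<ge> 9\<close> the slack in the factor \<open>sqrt 2\<close> absorbs
  \<open>1 / sqrt q\<close>. For \<open>q = 5\<close> the prime \<open>2\<close>, which divides
  \<open>N\<close> but not \<open>Q\<close>, supplies the missing slack, unless it is a sieving
  prime alongside at least seven that divide \<open>Q\<close>.\<close>

lemma nfree_pos_sqrt2:
  fixes P S
  defines "\<delta> \<equiv> 1 - (\<Sum>l\<in>S. 1 / real l)"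
  defines "\<rho> \<equiv> (\<Sum>l | l \<in> S \<and> l dvd Q. 1 - 1 / real l)"
  assumes n: "prime n" and fin: "finite P" "finite S" and disj: "P \<inter> S = {}"
    and PS: "P \<union> S = prime_factors N" and \<delta>: "\<delta> > 0"
    and main: "\<delta> * R > 2 * sqrt 2 * (real (card S) - 1 + 2 * \<delta>) * 2 ^ card P
      - sqrt 2 * (\<rho> + \<delta>) * WQ P"
  shows "nfree (prime_factors N) > 0"
proof -
  define a where "a = real (card S) - 1 + 2 * \<delta>"
  define b where "b = \<rho> + \<delta>"
  have prm: "prime l \<and> l dvd N" if "l \<in> P \<union> S" for l using that PS by auto
  have w_nonneg: "0 \<le> 1 - 1 / real l" if "l \<in> S" for l
    using prime_factor_weight[of l] prm that by auto
  have a_eq: "a = (\<Sum>l\<in>S. 1 - 1 / real l) + \<delta>"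
    by (simp add: a_def \<delta>_def sum_subtractf)
  have ab: "b \<le> a"
    unfolding a_eq b_def \<rho>_def using fin w_nonneg by (intro add_right_mono sum_mono2) auto
  have \<rho>0: "0 \<le> \<rho>" unfolding \<rho>_def using w_nonneg by (intro sum_nonneg) auto
  have b0: "0 < b" using \<rho>0 \<delta> by (simp add: b_def)
  have WQ0: "0 < WQ P" by (simp add: WQ_def)
  have WW: "WQ P \<le> 2 ^ card P" using fin(1) by (rule WQ_le)
  have s2: "sqrt 2 \<ge> 1.414" by (rule real_le_rsqrt) (simp add: power2_eq_square)
  have q5: "q \<ge> 5" using q_mod4 q_gt1 by presburger
  have "\<delta> * R > 2 * a * 2 ^ card P - (2 - c) * b * WQ P"
  proof -
    \<comment> \<open>The premise \<open>le\<close> rearranges the claim that the right side of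
      \<open>main\<close> is at least that of the criterion in \<open>nfree_pos\<close>.\<close>
    have reduce: ?thesis if le: "(sqrt 2 - 1 + 1 / sqrt (real q)) * (b * WQ P) \<le> 2 * (sqrt 2 - 1) * (a * 2 ^ card P)"
    proof -
      have "2 * a * 2 ^ card P - (2 - c) * b * WQ P \<le> 2 * sqrt 2 * a * 2 ^ card P - sqrt 2 * b * WQ P"
        using le unfolding c_def by (simp add: algebra_simps)
      thus ?thesis using main unfolding a_def b_def by linarith
    qed
    consider "q \<noteq> 5" | "q = 5" "2 \<in> P" | "q = 5" "2 \<in> S" "card {l\<in>S. l dvd Q} \<le> 6"
      | "q = 5" "2 \<in> S" "7 \<le> card {l\<in>S. l dvd Q}"
    proof -
      have "2 \<in> P \<union> S" using PS even_N N_pos by (simp add: prime_factors_dvd)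
      thus ?thesis using that by fastforce
    qed
    thus ?thesis
    proof cases
      case 1
      hence "9 \<le> q" using q_mod4 q5 by presburger
      hence "3 \<le> sqrt (real q)" by (intro real_le_rsqrt) simp
      hence "1 / sqrt (real q) \<le> 1 / 3" using q5 by (intro divide_left_mono) auto
      hence "sqrt 2 - 1 + 1 / sqrt (real q) \<le> 2 * (sqrt 2 - 1)" using s2 by simp
      thus ?thesis using s2 b0 ab WW WQ0 by (intro reduce mult_mono) auto
    next
      case 2
      \<comment> \<open>\<open>2\<close> lies in \<open>P\<close> but does not divide
        \<open>Q\<close>, so \<open>WQ P\<close> is at most half of
        \<open>2 ^ card P\<close>.\<close>
      have "{l\<in>P. l dvd Q} \<subset> P" using 2 odd_Q by auto
      hence "card {l\<in>P. l dvd Q} < card P" using fin by (intro psubset_card_mono)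
      hence "2 ^ Suc (card {l\<in>P. l dvd Q}) \<le> (2::real) ^ card P"
        by (intro power_increasing) auto
      hence W2: "2 * WQ P \<le> 2 ^ card P" by (simp add: WQ_def)
      have "2 \<le> sqrt (real q)" using q5 by (intro real_le_rsqrt) simp
      hence "1 / sqrt (real q) \<le> 1 / 2" using q5 by (intro divide_left_mono) auto
      hence "sqrt 2 - 1 + 1 / sqrt (real q) \<le> 2 * (sqrt 2 - 1) * 2" using s2 by simp
      hence "(sqrt 2 - 1 + 1 / sqrt (real q)) * (b * WQ P) \<le> 2 * (sqrt 2 - 1) * 2 * (b * WQ P)"
        using b0 WQ0 by (intro mult_right_mono) auto
      also have "\<dots> = 2 * (sqrt 2 - 1) * (b * (2 * WQ P))" by simp
      also have "\<dots> \<le> 2 * (sqrt 2 - 1) * (a * 2 ^ card P)"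
        using ab W2 b0 WQ0 s2 by (intro mult_left_mono mult_mono) auto
      finally show ?thesis by (rule reduce)
    next
      case 3
      have "\<rho> \<le> (\<Sum>l | l \<in> S \<and> l dvd Q. 1)" unfolding \<rho>_def by (intro sum_mono) auto
      also have "\<dots> \<le> 6" using 3(3) by simp
      finally have "\<rho> \<le> 6" .
      moreover have "\<delta> \<le> 1" unfolding \<delta>_def by (simp add: sum_nonneg)
      ultimately have b7: "b \<le> 7" by (simp add: b_def)
      \<comment> \<open>The sieving prime \<open>2\<close> adds \<open>1 - 1 / 2\<close> to
        \<open>a\<close> but nothing to \<open>b\<close>.\<close>
      have "a \<ge> b + 1 / 2"
      proof -
        have "\<rho> + 1 / 2 = (\<Sum>l\<in>insert 2 {l\<in>S. l dvd Q}. 1 - 1 / real l)"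
          unfolding \<rho>_def using fin odd_Q by simp
        also have "\<dots> \<le> (\<Sum>l\<in>S. 1 - 1 / real l)"
          using fin w_nonneg 3 by (intro sum_mono2) auto
        finally show ?thesis by (simp add: a_eq b_def)
      qed
      have "2.235 \<le> sqrt (real q)" using 3 by (intro real_le_rsqrt) (simp add: power2_eq_square)
      hence "1 / sqrt (real q) \<le> 1 / 2.235" using q5 by (intro divide_left_mono) auto
      hence q': "1 / sqrt (real q) \<le> 0.448" by simp
      have "(sqrt 2 - 1 + 1 / sqrt (real q)) * b \<le> (sqrt 2 - 1 + 0.448) * b"
        using q' b0 by (intro mult_right_mono) auto
      also have "\<dots> = 2 * (sqrt 2 - 1) * b + (1.448 - sqrt 2) * b"
        by (simp add: algebra_simps)
      \<comment> \<open>With \<open>b \<le> 7\<close> the excess is at most \<open>0.238\<close>,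
        covered by the gain \<open>sqrt 2 - 1\<close> from the extra \<open>1 / 2\<close> in
        \<open>a\<close>.\<close>
      also have "(1.448 - sqrt 2) * b \<le> 0.034 * 7"
        using s2 b0 b7 by (intro mult_mono) auto
      also have "2 * (sqrt 2 - 1) * b + 0.034 * 7 \<le> 2 * (sqrt 2 - 1) * (b + 1 / 2)"
        using s2 by (simp add: algebra_simps)
      also have "\<dots> \<le> 2 * (sqrt 2 - 1) * a"
        using \<open>a \<ge> b + 1 / 2\<close> s2 by (intro mult_left_mono) auto
      finally have "(sqrt 2 - 1 + 1 / sqrt (real q)) * b \<le> 2 * (sqrt 2 - 1) * a"
        by simp
      hence "(sqrt 2 - 1 + 1 / sqrt (real q)) * b * WQ P \<le> 2 * (sqrt 2 - 1) * a * 2 ^ card P"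
        by (rule mult_mono[OF _ WW]) (use WQ0 s2 ab b0 in auto)
      thus ?thesis by (intro reduce) (simp add: mult_ac)
    next
      case 4
      have "\<delta> * R > 2 * a * 2 ^ card P"
        unfolding a_def \<delta>_def using 4 n fin disj PS by (intro many_sieving_primes)
      moreover have "0 \<le> (2 - c) * b * WQ P"
        using c_bounds b0 WQ0 by simp
      ultimately show ?thesis by linarith
    qed
  qed
  hence "nfree (P \<union> S) > 0"
    using \<delta> fin disj prm unfolding a_def b_def \<delta>_def \<rho>_def by (intro nfree_pos) auto
  thus ?thesis by (simp add: PS)
qed

end

section \<open>The criterion in terms of numbered primes\<close>

theorem theorem6p6:
  fixes q n Q k s r kQ :: nat
    and p :: "nat \<Rightarrow> nat"
    and \<delta> \<delta>Q :: real
    and K :: "'a :: {field, finite} set"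
    and \<beta> :: 'a
  assumes "primepow q" and "[q = 1] (mod 4)"
    and "prime n" and "odd n"
    and "CARD('a) = q ^ n"
    and "is_subfield K" and "card K = q"
    and "\<beta> \<in> K" and "\<beta> \<noteq> 0"
    and "Q = (q ^ n - 1) div (q - 1)"
    and "\<Prod>(prime_factors (q ^ n - 1)) = k * (\<Prod>i=1..s. p i)"
    and "\<And>i. i \<in> {1..s} \<Longrightarrow> prime (p i)"
    and "inj_on p {1..s}"
    and "\<And>i. i \<in> {1..s} \<Longrightarrow> \<not> p i dvd k"
    and "r \<le> s"
    and "\<And>i. i \<in> {1..r} \<Longrightarrow> p i dvd Q"
    and "\<And>i. i \<in> {r<..s} \<Longrightarrow> \<not> p i dvd Q"
    and "\<delta> = 1 - (\<Sum>i=1..s. 1 / real (p i))"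
    and "\<delta>Q = 1 - (\<Sum>i=1..r. 1 / real (p i))"
    and "kQ = \<Prod>{l. prime l \<and> l dvd k \<and> l dvd Q}"
    and "\<delta> > 0"
    and "real q powr ((real n - 1) / 2) >
           2 * sqrt 2 * ((real s - 1) / \<delta> + 2) * real (W k)
           - sqrt 2 * ((real r - 1 + \<delta>Q) / \<delta> + 1) * real (W kQ)"
  shows "num_free q n \<beta> (q ^ n - 1) > 0"
proof -
  obtain g :: 'a where g: "g \<noteq> 0" "\<And>x. x \<noteq> 0 \<Longrightarrow> \<exists>i. x = g ^ i"
    using finite_field_generator_exists by blast
  interpret X: square_trace q n K g \<beta>
    using assms g prime_ge_2_nat[of n] by unfold_locales (auto simp: cong_def)
  have N: "X.N = q ^ n - 1" and Q: "X.Q = Q"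
    using assms by (simp_all add: X.N_def X.Q_def)
  define P where "P = prime_factors k"
  define S where "S = p ` {1..s}"
  have k0: "k \<noteq> 0"
  proof
    assume "k = 0"
    hence "\<Prod>(prime_factors (q ^ n - 1)) = 0" using assms(11) by simp
    thus False by (auto dest: in_prime_factors_imp_prime)
  qed
  have prodS: "(\<Prod>i=1..s. p i) = \<Prod>S"
    unfolding S_def using prod.reindex[OF assms(13), of "\<lambda>x. x"] by simp
  have primeS: "prime l" if "l \<in> S" for l using that assms(12) by (auto simp: S_def)
  have finS: "finite S" by (simp add: S_def)
  have S0: "\<Prod>S \<noteq> 0" using finS primeS by (auto dest: prime_gt_0_nat)
  have PS: "P \<union> S = prime_factors X.N"
  proof -
    have "prime_factors X.N = prime_factors (\<Prod>(prime_factors X.N))"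
      by (rule prime_factors_prod_primes[symmetric]) auto
    also have "\<dots> = prime_factors (k * \<Prod>S)" using assms(11) N prodS by simp
    also have "\<dots> = P \<union> prime_factors (\<Prod>S)"
      using k0 S0 by (simp add: prime_factors_product P_def)
    also have "prime_factors (\<Prod>S) = S"
      using finS primeS by (rule prime_factors_prod_primes)
    finally show ?thesis ..
  qed
  have disj: "P \<inter> S = {}" using assms(14) by (auto simp: P_def S_def)
  have SQ: "{l. l \<in> S \<and> l dvd X.Q} = p ` {1..r}"
  proof -
    have "p i dvd Q \<longleftrightarrow> i \<le> r" if "i \<in> {1..s}" for i
      using that assms(16)[of i] assms(17)[of i] by (cases "i \<le> r") auto
    thus ?thesis using assms(15) by (auto simp: S_def Q)
  qed
  have injr: "inj_on p {1..r}" by (rule inj_on_subset[OF assms(13)]) (use assms(15) in auto)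
  have \<delta>: "\<delta> = 1 - (\<Sum>l\<in>S. 1 / real l)"
    unfolding assms(18) S_def sum.reindex[OF assms(13)] by simp
  have \<rho>: "(\<Sum>l | l \<in> S \<and> l dvd X.Q. 1 - 1 / real l) = real r - 1 + \<delta>Q"
    unfolding SQ assms(19) sum.reindex[OF injr] by (simp add: sum_subtractf)
  have cardS: "card S = s" unfolding S_def card_image[OF assms(13)] by simp
  have Wk: "real (W k) = 2 ^ card P" by (simp add: W_def P_def)
  have WkQ: "real (W kQ) = X.WQ P"
  proof -
    have "{l. prime l \<and> l dvd k \<and> l dvd Q} = {l \<in> P. l dvd Q}"
      using k0 by (auto simp: P_def prime_factors_dvd)
    moreover have "prime_factors (\<Prod>{l \<in> P. l dvd Q}) = {l \<in> P. l dvd Q}"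
      by (rule prime_factors_prod_primes) (auto simp: P_def)
    ultimately show ?thesis unfolding assms(20) W_def X.WQ_def Q by simp
  qed
  have R: "real q powr ((real n - 1) / 2) = X.R"
  proof -
    have "real ((n - 1) div 2) = (real n - 1) / 2"
      using assms(4) X.n_ge2 by (auto elim!: oddE)
    hence "real q powr ((real n - 1) / 2) = real q powr real ((n - 1) div 2)" by (simp only:)
    thus ?thesis using X.q_gt1 by (simp add: X.R_def powr_realpow)
  qed
  have "X.nfree (prime_factors X.N) > 0"
  proof (rule X.nfree_pos_sqrt2[of P S])
    \<comment> \<open>Multiplying the hypothesis by \<open>\<delta>\<close> clears its
      denominators.\<close>
    have "\<delta> * X.R > \<delta> * (2 * sqrt 2 * ((real s - 1) / \<delta> + 2) * 2 ^ card P
        - sqrt 2 * ((real r - 1 + \<delta>Q) / \<delta> + 1) * X.WQ P)"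
      using assms(21,22) unfolding R Wk WkQ by (intro mult_strict_left_mono)
    also have "\<delta> * (2 * sqrt 2 * ((real s - 1) / \<delta> + 2) * 2 ^ card P
        - sqrt 2 * ((real r - 1 + \<delta>Q) / \<delta> + 1) * X.WQ P)
      = 2 * sqrt 2 * (\<delta> * ((real s - 1) / \<delta> + 2)) * 2 ^ card P
        - sqrt 2 * (\<delta> * ((real r - 1 + \<delta>Q) / \<delta> + 1)) * X.WQ P"
      by (simp only: right_diff_distrib mult_ac)
    also have "\<delta> * ((real s - 1) / \<delta> + 2) = real (card S) - 1 + 2 * \<delta>"
      using assms(21) cardS by (simp add: distrib_left)
    also have "\<delta> * ((real r - 1 + \<delta>Q) / \<delta> + 1) = real r - 1 + \<delta>Q + \<delta>"
      using assms(21) by (simp add: field_simps)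
    finally show "(1 - (\<Sum>l\<in>S. 1 / real l)) * X.R >
        2 * sqrt 2 * (real (card S) - 1 + 2 * (1 - (\<Sum>l\<in>S. 1 / real l))) * 2 ^ card P
        - sqrt 2 * ((\<Sum>l | l \<in> S \<and> l dvd X.Q. 1 - 1 / real l) + (1 - (\<Sum>l\<in>S. 1 / real l))) * X.WQ P"
      unfolding \<rho> \<delta>[symmetric] by simp
    show "1 - (\<Sum>l\<in>S. 1 / real l) > 0" using assms(21) \<delta> by simp
  qed (use assms(3) finS disj PS in \<open>auto simp: P_def\<close>)
  thus ?thesis using X.nfree_imp_num_free N by simp
qed

end
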